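(* Let $m:\mathbb N\times\mathbb N\to\mathbb N$ be any function and let $\mathcal F=\{f_{N,k}:\{0,1\}^{m(N,k)\times k}\to\{0,1\}\}_{N,k\in\mathbb N}$ be a family of Boolean functions indexed by $N,k$. Suppose that there exists a $(w,r,\ell,s)$-efficient protocol for $f_{N,k}$ in the $k$-player simultaneous message passing model for every $N,k\in\mathbb N$ (where $w,r,\ell,s$ can depend on $N$ and $k$). Then there is a reduction from any instance $(A_1,\dots,A_k)$ of $\mathrm{PSP}(k,\mathcal F,N)$ to $2^w$ label cover instances $\{\Gamma^\mu\}_{\mu\in\{0,1\}^w}$ such that: (1) the running time of the reduction is $2^{w+r+\ell k}\,\mathrm{poly}(m(N,k))$; (2) each $\Gamma^\mu=(U^\mu=U^\mu_1\cup\dots\cup U^\mu_q,\ W^\mu=W^\mu_1\cup\dots\cup W^\mu_h;\ E^\mu)$ has at most $Nk$ right nodes ($|W^\mu|\le Nk$), has $h=k$ right super-nodes, has $q=2^r$ left super-nodes, and has left alphabet size at most $2^{\ell k}$ ($|U^\mu_1|,\dots,|U^\mu_q|\le 2^{\ell k}$); (3) if $(A_1,\dots,A_k)$ is a YES instance of $\mathrm{PSP}(k,\mathcal F,N)$, then $\mathrm{MaxCover}(\Gamma^\mu)=1$ for some $\mu\in\{0,1\}^w$; (4) if $(A_1,\dots,A_k)$ is a NO instance of $\mathrm{PSP}(k,\mathcal F,N)$, then $\mathrm{MaxCover}(\Gamma^\mu)\le s$ for every $\mu\in\{0,1\}^w$.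
   Context: Product space problem: an instance of $\mathrm{PSP}(k,\mathcal F,N)$ consists of $k$ explicitly listed subsets $A_1,\dots,A_k\subseteq\{0,1\}^{m(N,k)}$, each of cardinality at most $N$; it is a YES instance if there is $(a_1,\dots,a_k)\in A_1\times\cdots\times A_k$ with $f_{N,k}(a_1,\dots,a_k)=1$, and a NO instance otherwise. Label cover and MaxCover: a label cover instance $\Gamma$ is a bipartite graph $(U,W;E)$ with $U$ partitioned into $U_1\cup\dots\cup U_q$ (left super-nodes) and $W$ partitioned into $W_1\cup\dots\cup W_h$ (right super-nodes). A labeling is a set $S\subseteq W$ with $|S\cap W_j|=1$ for all $j\in[h]$. A labeling $S$ covers $U_i$ if some $u\in U_i$ is adjacent to every vertex of $S$. $\mathrm{MaxCover}(\Gamma)$ is the maximum over labelings $S$ of the fraction of left super-nodes covered by $S$. The left alphabet size is $\max_i|U_i|$. Efficient protocols: let $f:\{0,1\}^{m\times k}\to\{0,1\}$. In the $k$-player simultaneous message passing (SMP) model, player $i$ holds $x_i\in\{0,1\}^m$, and a referee, who holds an advice string, must decide whether $f(x_1,\dots,x_k)=1$. A $(w,r,\ell,s)$-efficient protocol is one in which: the referee receives $w$ bits of advice; the players and the referee jointly toss $r$ public random coins; each player, as a deterministic function of its input and the coins, sends an $\ell$-bit message to the referee; based on the advice, the coins and the $\ell k$ bits received, the referee accepts or rejects; if $f(x_1,\dots,x_k)=1$ then there is an advice on which the referee always accepts; if $f(x_1,\dots,x_k)=0$ then on any advice the referee accepts with probability at most $s$; and the players and the referee perform all their computations in $\mathrm{poly}(m)$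 time.
   Formalization: The running time proved is 2^{w+r+ℓk}·poly(m(N,k)) times 1+k+|A_1|+…+|A_k|, linear in the input listing; without this factor the claim fails, as the reduction could not read its input. The bound s is taken in [0,1]. *)

theory Defs
  imports "HOL-Probability.Probability" "HOL-Computational_Algebra.Polynomial"
begin

section \<open>Model of computation\<close>

text \<open>
  Running times are measured in Jones' WHILE language: imperative programs over binary trees
  (S-expressions) with finitely many variables, in which building a pair, taking a component,
  reading a variable, assigning and testing cost one step each. Trees are passed by reference, so
  this is a pointer machine: it is simulated by a logarithmic-cost RAM with logarithmic overhead
  per step, and polynomial time coincides with polynomial time on Turing machines. There is no
  unit-cost comparison of trees and no unit-cost arithmetic.
\<close>

datatype data = Atom | Pair data data

fun dfst :: "data \<Rightarrow> data" where
  "dfst Atom = Atom"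
| "dfst (Pair x y) = x"

fun dsnd :: "data \<Rightarrow> data" where
  "dsnd Atom = Atom"
| "dsnd (Pair x y) = y"

datatype expr = Var nat | NilE | ConsE expr expr | Hd expr | Tl expr

type_synonym store = "nat \<Rightarrow> data"

fun eval_expr :: "expr \<Rightarrow> store \<Rightarrow> data" where
  "eval_expr (Var i) \<sigma> = \<sigma> i"
| "eval_expr NilE \<sigma> = Atom"
| "eval_expr (ConsE a b) \<sigma> = Pair (eval_expr a \<sigma>) (eval_expr b \<sigma>)"
| "eval_expr (Hd a) \<sigma> = dfst (eval_expr a \<sigma>)"
| "eval_expr (Tl a) \<sigma> = dsnd (eval_expr a \<sigma>)"

fun expr_cost :: "expr \<Rightarrow> nat" where
  "expr_cost (Var i) = 1"
| "expr_cost NilE = 1"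
| "expr_cost (ConsE a b) = Suc (expr_cost a + expr_cost b)"
| "expr_cost (Hd a) = Suc (expr_cost a)"
| "expr_cost (Tl a) = Suc (expr_cost a)"

datatype prog = Assign nat expr | Seq prog prog | If expr prog prog | While expr prog

text \<open>\<open>exec c \<sigma> t \<tau>\<close>: started in \<open>\<sigma>\<close>, the program \<open>c\<close> halts in \<open>\<tau>\<close> after exactly \<open>t\<close> steps.
  In tests, \<open>Atom\<close> counts as false and every pair as true.\<close>

inductive exec :: "prog \<Rightarrow> store \<Rightarrow> nat \<Rightarrow> store \<Rightarrow> bool" where
  exec_Assign: "exec (Assign i e) \<sigma> (Suc (expr_cost e)) (\<sigma>(i := eval_expr e \<sigma>))"
| exec_Seq: "exec c \<sigma> t \<tau> \<Longrightarrow> exec d \<tau> u \<rho> \<Longrightarrow> exec (Seq c d) \<sigma> (t + u) \<rho>"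
| exec_If_true: "eval_expr e \<sigma> \<noteq> Atom \<Longrightarrow> exec c \<sigma> t \<tau> \<Longrightarrow>
    exec (If e c d) \<sigma> (Suc (expr_cost e + t)) \<tau>"
| exec_If_false: "eval_expr e \<sigma> = Atom \<Longrightarrow> exec d \<sigma> t \<tau> \<Longrightarrow>
    exec (If e c d) \<sigma> (Suc (expr_cost e + t)) \<tau>"
| exec_While_false: "eval_expr e \<sigma> = Atom \<Longrightarrow> exec (While e c) \<sigma> (Suc (expr_cost e)) \<sigma>"
| exec_While_true: "eval_expr e \<sigma> \<noteq> Atom \<Longrightarrow> exec c \<sigma> t \<tau> \<Longrightarrow> exec (While e c) \<tau> u \<rho> \<Longrightarrow>
    exec (While e c) \<sigma> (Suc (expr_cost e + t + u)) \<rho>"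

inductive_cases exec_AssignE: "exec (Assign i e) \<sigma> t \<tau>"
inductive_cases exec_SeqE: "exec (Seq c d) \<sigma> t \<tau>"
inductive_cases exec_IfE: "exec (If e c d) \<sigma> t \<tau>"
inductive_cases exec_WhileE: "exec (While e c) \<sigma> t \<tau>"

lemma exec_deterministic:
  "exec c \<sigma> t \<tau> \<Longrightarrow> exec c \<sigma> t' \<tau>' \<Longrightarrow> t' = t \<and> \<tau>' = \<tau>"
proof (induction arbitrary: t' \<tau>' rule: exec.induct)
  case (exec_Seq c \<sigma> t \<tau> d u \<rho>)
  obtain t1 \<tau>1 u1 where 1: "t' = t1 + u1" "exec c \<sigma> t1 \<tau>1" "exec d \<tau>1 u1 \<tau>'"
    using exec_Seq.prems by (rule exec_SeqE)
  have 2: "t1 = t \<and> \<tau>1 = \<tau>" by (rule exec_Seq.IH(1)[OF 1(2)])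
  have "u1 = u \<and> \<tau>' = \<rho>" by (rule exec_Seq.IH(2)) (use 1 2 in simp)
  with 1 2 show ?case by simp
next
  case (exec_While_true e \<sigma> c t \<tau> u \<rho>)
  obtain t1 \<tau>1 u1 where 1: "t' = Suc (expr_cost e + t1 + u1)"
      "exec c \<sigma> t1 \<tau>1" "exec (While e c) \<tau>1 u1 \<tau>'"
    using exec_While_true.prems by (rule exec_WhileE) (use exec_While_true.hyps in simp_all)
  have 2: "t1 = t \<and> \<tau>1 = \<tau>" by (rule exec_While_true.IH(1)[OF 1(2)])
  have "u1 = u \<and> \<tau>' = \<rho>" by (rule exec_While_true.IH(2)) (use 1 2 in simp)
  with 1 2 show ?case by simp
next
  case (exec_Assign i e \<sigma>)
  then show ?case by (rule exec_AssignE) simp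
next
  case (exec_If_true e \<sigma> c t \<tau> d)
  from exec_If_true.prems show ?case
    by (rule exec_IfE) (use exec_If_true.hyps in \<open>auto dest: exec_If_true.IH\<close>)
next
  case (exec_If_false e \<sigma> d t \<tau> c)
  from exec_If_false.prems show ?case
    by (rule exec_IfE) (use exec_If_false.hyps in \<open>auto dest: exec_If_false.IH\<close>)
next
  case (exec_While_false e \<sigma> c)
  from exec_While_false.prems show ?case
    by (rule exec_WhileE) (use exec_While_false.hyps in auto)
qed

text \<open>Variable 0 holds the input at the start and the output at the end.\<close>

definition computes_within :: "prog \<Rightarrow> data \<Rightarrow> data \<Rightarrow> nat \<Rightarrow> bool" where
  "computes_within c inp out T \<longleftrightarrow>
     (\<exists>t \<tau>. exec c ((\<lambda>_. Atom)(0 := inp)) t \<tau> \<and> \<tau> 0 = out \<and> t \<le> T)"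


subsection \<open>Encodings\<close>

type_synonym bits = "bool list"

definition bitstrings :: "nat \<Rightarrow> bits set" where
  "bitstrings n = {x. length x = n}"

fun enc_list :: "data list \<Rightarrow> data" where
  "enc_list [] = Atom"
| "enc_list (x # xs) = Pair x (enc_list xs)"

fun enc_bool :: "bool \<Rightarrow> data" where
  "enc_bool False = Atom"
| "enc_bool True = Pair Atom Atom"

definition enc_bits :: "bits \<Rightarrow> data" where
  "enc_bits x = enc_list (map enc_bool x)"

definition enc_unary :: "nat \<Rightarrow> data" where
  "enc_unary n = enc_list (replicate n Atom)"

fun binary :: "nat \<Rightarrow> bits" where
  "binary n = (if n = 0 then [] else odd n # binary (n div 2))"

declare binary.simps [simp del]

text \<open>The parameters are known to the players, the referee and the reduction: the indices
  \<open>N\<close>, \<open>k\<close> in binary (least significant bit first), the lengths \<open>m\<close>, \<open>w\<close>, \<open>r\<close>, \<open>l\<close> in unary.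
  The lengths have to be supplied because they are arbitrary, possibly uncomputable, functions
  of \<open>N\<close> and \<open>k\<close>.\<close>

definition enc_params :: "nat \<Rightarrow> nat \<Rightarrow> nat \<Rightarrow> nat \<Rightarrow> nat \<Rightarrow> nat \<Rightarrow> data" where
  "enc_params N k m w r l =
     enc_list [enc_bits (binary N), enc_bits (binary k),
               enc_unary m, enc_unary w, enc_unary r, enc_unary l]"


section \<open>Simultaneous message passing protocols\<close>

text \<open>
  A Boolean function on \<open>{0,1}\<^bsup>m\<times>k\<^esup>\<close> is a predicate on lists of bit strings, of which only the
  values on \<open>smp_inputs m k\<close> matter.
\<close>

definition smp_inputs :: "nat \<Rightarrow> nat \<Rightarrow> bits list set" where
  "smp_inputs m k = {xs. length xs = k \<and> set xs \<subseteq> bitstrings m}"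

text \<open>\<open>msg j x \<gamma>\<close> is the message of player \<open>j\<close> (numbered from 0) on input \<open>x\<close> and coins \<open>\<gamma>\<close>;
  \<open>acc \<mu> \<gamma> ms\<close> is the decision of the referee on advice \<open>\<mu>\<close>, coins \<open>\<gamma>\<close> and messages \<open>ms\<close>.\<close>

definition transcript :: "(nat \<Rightarrow> bits \<Rightarrow> bits \<Rightarrow> bits) \<Rightarrow> bits \<Rightarrow> bits list \<Rightarrow> bits list" where
  "transcript msg \<gamma> xs = map (\<lambda>j. msg j (xs ! j) \<gamma>) [0..<length xs]"

definition smp_protocol ::
  "nat \<Rightarrow> nat \<Rightarrow> (bits list \<Rightarrow> bool) \<Rightarrow> nat \<Rightarrow> nat \<Rightarrow> nat \<Rightarrow> real \<Rightarrow>
   (nat \<Rightarrow> bits \<Rightarrow> bits \<Rightarrow> bits) \<Rightarrow> (bits \<Rightarrow> bits \<Rightarrow> bits list \<Rightarrow> bool) \<Rightarrow> bool" where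
  "smp_protocol m k f w r l s msg acc \<longleftrightarrow>
     0 \<le> s \<and> s \<le> 1 \<and>
     (\<forall>j<k. \<forall>x\<in>bitstrings m. \<forall>\<gamma>\<in>bitstrings r. msg j x \<gamma> \<in> bitstrings l) \<and>
     (\<forall>xs\<in>smp_inputs m k. f xs \<longrightarrow>
        (\<exists>\<mu>\<in>bitstrings w. \<forall>\<gamma>\<in>bitstrings r. acc \<mu> \<gamma> (transcript msg \<gamma> xs))) \<and>
     (\<forall>xs\<in>smp_inputs m k. \<not> f xs \<longrightarrow>
        (\<forall>\<mu>\<in>bitstrings w.
           measure_pmf.prob (pmf_of_set (bitstrings r))
             {\<gamma>. acc \<mu> \<gamma> (transcript msg \<gamma> xs)} \<le> s))"

text \<open>Efficiency is asymptotic: one program for the players (which is told the player's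
  number), one for the referee, and one polynomial in \<open>m(N,k)\<close> work for all \<open>N\<close> and \<open>k\<close>.\<close>

definition efficient_protocols ::
  "(nat \<Rightarrow> nat \<Rightarrow> nat) \<Rightarrow> (nat \<Rightarrow> nat \<Rightarrow> bits list \<Rightarrow> bool) \<Rightarrow>
   (nat \<Rightarrow> nat \<Rightarrow> nat) \<Rightarrow> (nat \<Rightarrow> nat \<Rightarrow> nat) \<Rightarrow> (nat \<Rightarrow> nat \<Rightarrow> nat) \<Rightarrow> (nat \<Rightarrow> nat \<Rightarrow> real) \<Rightarrow> bool"
where
  "efficient_protocols m f w r l s \<longleftrightarrow>
     (\<exists>msg acc player referee. \<exists>p :: nat poly. \<forall>N k.
        let par = enc_params N k (m N k) (w N k) (r N k) (l N k) in
        smp_protocol (m N k) k (f N k) (w N k) (r N k) (l N k) (s N k) (msg N k) (acc N k) \<and>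
        (\<forall>j<k. \<forall>x\<in>bitstrings (m N k). \<forall>\<gamma>\<in>bitstrings (r N k).
           computes_within player
             (enc_list [par, enc_bits (binary j), enc_bits x, enc_bits \<gamma>])
             (enc_bits (msg N k j x \<gamma>)) (poly p (m N k))) \<and>
        (\<forall>\<mu>\<in>bitstrings (w N k). \<forall>\<gamma>\<in>bitstrings (r N k). \<forall>ms\<in>smp_inputs (l N k) k.
           computes_within referee
             (enc_list [par, enc_bits \<mu>, enc_bits \<gamma>, enc_list (map enc_bits ms)])
             (enc_bool (acc N k \<mu> \<gamma> ms)) (poly p (m N k))))"


section \<open>The product space problem\<close>

text \<open>An instance is an explicit listing (without repetitions) of the sets.\<close>

definition psp_instance :: "nat \<Rightarrow> nat \<Rightarrow> nat \<Rightarrow> bits list list \<Rightarrow> bool" where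
  "psp_instance m k N As \<longleftrightarrow>
     length As = k \<and> (\<forall>A\<in>set As. distinct A \<and> length A \<le> N \<and> set A \<subseteq> bitstrings m)"

definition psp_yes :: "(bits list \<Rightarrow> bool) \<Rightarrow> bits list list \<Rightarrow> bool" where
  "psp_yes f As \<longleftrightarrow> (\<exists>xs. list_all2 (\<lambda>x A. x \<in> set A) xs As \<and> f xs)"

text \<open>Number of entries of the listing: the sets and all their elements (plus 1, for \<open>k = 0\<close>).
  The running time of the reduction is \<open>2\<^bsup>w+r+lk\<^esup> poly(m)\<close> per entry: without a linear dependence
  on the length of the listing the reduction could not read its input when \<open>N\<close> is large (e.g. for
  the equality function on \<open>m = 2 log N\<close> bits, where \<open>2\<^bsup>w+r+lk\<^esup> poly(m)\<close> is polylogarithmic in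
  \<open>N\<close>).\<close>

definition psp_size :: "bits list list \<Rightarrow> nat" where
  "psp_size As = 1 + length As + sum_list (map length As)"

definition enc_psp :: "bits list list \<Rightarrow> data" where
  "enc_psp As = enc_list (map (\<lambda>A. enc_list (map enc_bits A)) As)"


section \<open>Label cover\<close>

text \<open>Super-nodes may be empty.\<close>

record ('u, 'v) label_cover =
  left_super :: "'u set list"
  right_super :: "'v set list"
  edges :: "('u \<times> 'v) set"

definition left_nodes :: "('u, 'v) label_cover \<Rightarrow> 'u set" where
  "left_nodes G = \<Union>(set (left_super G))"

definition right_nodes :: "('u, 'v) label_cover \<Rightarrow> 'v set" where
  "right_nodes G = \<Union>(set (right_super G))"

definition label_cover_instance :: "('u, 'v) label_cover \<Rightarrow> bool" where
  "label_cover_instance G \<longleftrightarrow>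
     finite (left_nodes G) \<and> finite (right_nodes G) \<and>
     disjoint_family_on ((!) (left_super G)) {..<length (left_super G)} \<and>
     disjoint_family_on ((!) (right_super G)) {..<length (right_super G)} \<and>
     edges G \<subseteq> left_nodes G \<times> right_nodes G"

definition labeling :: "('u, 'v) label_cover \<Rightarrow> 'v set \<Rightarrow> bool" where
  "labeling G S \<longleftrightarrow> S \<subseteq> right_nodes G \<and> (\<forall>V\<in>set (right_super G). card (S \<inter> V) = 1)"

definition covers :: "('u, 'v) label_cover \<Rightarrow> 'v set \<Rightarrow> 'u set \<Rightarrow> bool" where
  "covers G S U \<longleftrightarrow> (\<exists>u\<in>U. \<forall>v\<in>S. (u, v) \<in> edges G)"

definition covered_fraction :: "('u, 'v) label_cover \<Rightarrow> 'v set \<Rightarrow> real" where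
  "covered_fraction G S =
     real (card {i. i < length (left_super G) \<and> covers G S (left_super G ! i)})
       / real (length (left_super G))"

text \<open>The element 0 only matters if there is no labeling, i.e. if some right super-node is empty;
  the maximum is then 0 by convention.\<close>

definition max_cover :: "('u, 'v) label_cover \<Rightarrow> real" where
  "max_cover G = Max (insert 0 (covered_fraction G ` {S. labeling G S}))"

definition left_alphabet_size :: "('u, 'v) label_cover \<Rightarrow> nat" where
  "left_alphabet_size G = Max (card ` set (left_super G))"

text \<open>An instance is output by listing the nodes of each super-node and all edges; nodes are named
  by trees.\<close>

definition lists_label_cover :: "data \<Rightarrow> (data, data) label_cover \<Rightarrow> bool" where
  "lists_label_cover d G \<longleftrightarrow>
     (\<exists>us vs es.
        d = enc_list [enc_list (map enc_list us), enc_list (map enc_list vs),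
                      enc_list (map (\<lambda>(u, v). Pair u v) es)] \<and>
        left_super G = map set us \<and> right_super G = map set vs \<and> edges G = set es)"

end

theory Submission
  imports Defs
begin

text \<open>
  The left super-node of the coins \<open>\<gamma>\<close> in the instance for the advice \<open>\<mu>\<close> consists of the message
  tuples that the referee accepts; such a tuple is adjacent to an input \<open>x\<close> of player \<open>j\<close> iff its
  \<open>j\<close>-th component is the message of \<open>j\<close> on \<open>x\<close> and \<open>\<gamma>\<close>. A labeling is a choice of inputs, and it
  covers the super-node of \<open>\<gamma>\<close> iff the referee accepts the transcript of that choice, so the covered
  fraction is the acceptance probability.

  The running time leaves only \<open>poly(m)\<close> steps for each choice of \<open>\<mu>\<close>, \<open>\<gamma>\<close>, message tuple and
  input, although neither the message length \<open>l\<close> nor \<open>log k\<close> is bounded by a polynomial in \<open>m\<close>.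
  Comparisons of messages stop at the first difference, which takes constant time on average over
  all tuples, and the numbers of the players come from a binary counter with constant amortised cost.
\<close>

section \<open>Timed execution\<close>

text \<open>Messages can be longer than any polynomial in \<open>m\<close> because trees are passed
  by reference: a player that returns its coin string answers in constant time with a message of
  \<open>r\<close> bits. A worst-case bound for a single comparison would therefore be useless, and
  the costs \<open>element_time\<close> and \<open>tuple_time\<close> keep their dependence on the
  message tuple until they are summed over all tuples. Small parameters need care as well: for
  \<open>l = 0\<close> the enumeration of tuples is no longer dominated by its last stage, and for
  \<open>k = 0\<close> even the list of all \<open>2 ^ l\<close> messages exceeds the budget.

  Specifications of programs have the form \<open>runs\<close>, with an exact final store but only
  an upper bound on the time. The convention behind them is that scratch registers hold
  \<open>Atom\<close> before and after every subprogram, since the given players and referee are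
  only known to work from a store that is \<open>Atom\<close> apart from the input.\<close>

definition runs :: "prog \<Rightarrow> store \<Rightarrow> nat \<Rightarrow> store \<Rightarrow> bool" where
  "runs c \<sigma> T \<tau> \<longleftrightarrow> (\<exists>t\<le>T. exec c \<sigma> t \<tau>)"

lemma runs_Assign:
  assumes "\<tau> = \<sigma>(i := eval_expr e \<sigma>)" "Suc (expr_cost e) \<le> T"
  shows "runs (Assign i e) \<sigma> T \<tau>"
  using assms exec_Assign unfolding runs_def by blast

lemma runs_Seq:
  assumes "runs c \<sigma> T \<tau>" "runs d \<tau> U \<rho>" "T + U \<le> V"
  shows "runs (Seq c d) \<sigma> V \<rho>"
  using assms unfolding runs_def by (meson add_le_mono exec_Seq le_trans)

lemma runs_If:
  assumes "eval_expr e \<sigma> \<noteq> Atom \<Longrightarrow> runs c \<sigma> T \<tau>" "eval_expr e \<sigma> = Atom \<Longrightarrow> runs d \<sigma> T \<tau>"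
    and "Suc (expr_cost e + T) \<le> U"
  shows "runs (If e c d) \<sigma> U \<tau>"
proof (cases "eval_expr e \<sigma> = Atom")
  case True
  then obtain t where "t \<le> T" "exec d \<sigma> t \<tau>" using assms(2) unfolding runs_def by blast
  with exec_If_false[OF True] assms(3) show ?thesis unfolding runs_def
    by (intro exI[of _ "Suc (expr_cost e + t)"]) auto
next
  case False
  then obtain t where "t \<le> T" "exec c \<sigma> t \<tau>" using assms(1) unfolding runs_def by blast
  with exec_If_true[OF False] assms(3) show ?thesis unfolding runs_def
    by (intro exI[of _ "Suc (expr_cost e + t)"]) auto
qed

lemma runs_While_false:
  assumes "eval_expr e \<sigma> = Atom" "\<tau> = \<sigma>" "Suc (expr_cost e) \<le> T"
  shows "runs (While e c) \<sigma> T \<tau>"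
  using assms exec_While_false unfolding runs_def by blast

lemma runs_While_true:
  assumes "eval_expr e \<sigma> \<noteq> Atom" "runs c \<sigma> T \<tau>" "runs (While e c) \<tau> U \<rho>"
    and "Suc (expr_cost e + T + U) \<le> V"
  shows "runs (While e c) \<sigma> V \<rho>"
proof -
  obtain t u where "t \<le> T" "exec c \<sigma> t \<tau>" "u \<le> U" "exec (While e c) \<tau> u \<rho>"
    using assms(2,3) unfolding runs_def by blast
  with exec_While_true[OF assms(1)] assms(4) show ?thesis unfolding runs_def
    by (intro exI[of _ "Suc (expr_cost e + t + u)"]) auto
qed

lemma runs_mono: "runs c \<sigma> T \<tau> \<Longrightarrow> T \<le> U \<Longrightarrow> runs c \<sigma> U \<tau>"
  unfolding runs_def by (meson le_trans)

section \<open>Loops over lists and their accumulated cost\<close>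

definition foreach :: "nat \<Rightarrow> nat \<Rightarrow> expr \<Rightarrow> prog \<Rightarrow> prog" where
  "foreach x v e c = Seq (Assign v e)
     (Seq (While (Var v) (Seq (Assign x (Hd (Var v))) (Seq (Assign v (Tl (Var v))) c)))
        (Assign x NilE))"

text \<open>Potential argument: \<open>F ys\<close> is the store, apart from the two loop registers,
  once the prefix \<open>ys\<close> has been processed, and \<open>G\<close> bounds the time
  accumulated up to then. Bounding accumulated time instead of single rounds admits amortised costs.
  The 8 pays for the loop test and the two assignments that fetch an element, the final 2 for the
  failing test.\<close>

lemma runs_foreach_loop:
  assumes "x \<noteq> v"
    and body: "\<And>ys d zs. xs = ys @ d # zs \<Longrightarrow>
      runs c ((F ys)(v := enc_list (map en zs), x := en d)) (T ys d)
        ((F (ys @ [d]))(v := enc_list (map en zs), x := en d))"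
    and G: "\<And>ys d zs. xs = ys @ d # zs \<Longrightarrow> G ys + T ys d + 8 \<le> G (ys @ [d])"
  shows "xs = ys @ zs \<Longrightarrow> \<exists>b. runs
      (While (Var v) (Seq (Assign x (Hd (Var v))) (Seq (Assign v (Tl (Var v))) c)))
      ((F ys)(v := enc_list (map en zs), x := a)) (G xs - G ys + 2) ((F xs)(v := Atom, x := b))"
proof (induction zs arbitrary: ys a)
  case Nil
  have "runs (While (Var v) (Seq (Assign x (Hd (Var v))) (Seq (Assign v (Tl (Var v))) c)))
      ((F ys)(v := enc_list (map en []), x := a)) (G xs - G ys + 2) ((F xs)(v := Atom, x := a))"
    by (rule runs_While_false) (use Nil assms(1) in auto)
  then show ?case by blast
next
  case (Cons d zs)
  let ?W = "While (Var v) (Seq (Assign x (Hd (Var v))) (Seq (Assign v (Tl (Var v))) c))"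
  \<comment> \<open>Differences of \<open>G\<close> are natural numbers, so \<open>G\<close> has to
    be nondecreasing along the prefixes of \<open>xs\<close> before they can be telescoped.\<close>
  have mono: "G (ys @ [d]) \<le> G xs" if "xs = (ys @ [d]) @ zs" for zs ys d
    using that
  proof (induction zs arbitrary: ys d)
    case (Cons e zs)
    then have "G (ys @ [d] @ [e]) \<le> G xs" by simp
    moreover have "G (ys @ [d]) \<le> G ((ys @ [d]) @ [e])"
      using G[of "ys @ [d]" e zs] Cons.prems by simp
    ultimately show ?case by simp
  qed simp
  have split: "xs = (ys @ [d]) @ zs" using Cons.prems by simp
  obtain b where b: "runs ?W ((F (ys @ [d]))(v := enc_list (map en zs), x := en d))
      (G xs - G (ys @ [d]) + 2) ((F xs)(v := Atom, x := b))"
    using Cons.IH[OF split, of "en d"] ..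
  have 1: "runs (Seq (Assign x (Hd (Var v))) (Seq (Assign v (Tl (Var v))) c))
      ((F ys)(v := enc_list (map en (d # zs)), x := a)) (3 + (3 + T ys d))
      ((F (ys @ [d]))(v := enc_list (map en zs), x := en d))"
    apply (rule runs_Seq[where T=3 and U="3 + T ys d"], rule runs_Assign, rule refl, simp)
     apply (rule runs_Seq[where T=3 and U="T ys d"], rule runs_Assign, rule refl, simp)
      apply (use body[OF Cons.prems] assms(1) in \<open>simp add: fun_upd_twist\<close>)
    by simp_all
  have "runs ?W ((F ys)(v := enc_list (map en (d # zs)), x := a)) (G xs - G ys + 2)
      ((F xs)(v := Atom, x := b))"
    by (rule runs_While_true[OF _ 1 b])
      (use assms(1) G[OF Cons.prems] mono[of ys d zs] Cons.prems in auto)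
  then show ?case by blast
qed

text \<open>The last assignment of \<open>foreach\<close> clears \<open>x\<close>, so both loop
  registers end as \<open>Atom\<close> although the loop leaves an element in \<open>x\<close>. The
  term \<open>5 + expr_cost e\<close> pays for initialising \<open>v\<close>, the failing test and
  this clearing.\<close>

lemma runs_foreach_gen:
  assumes "x \<noteq> v" "eval_expr e \<sigma> = enc_list (map en xs)" "F [] = \<sigma>"
    and body: "\<And>ys d zs. xs = ys @ d # zs \<Longrightarrow>
      runs c ((F ys)(v := enc_list (map en zs), x := en d)) (T ys d)
        ((F (ys @ [d]))(v := enc_list (map en zs), x := en d))"
    and G: "\<And>ys d zs. xs = ys @ d # zs \<Longrightarrow> G ys + T ys d + 8 \<le> G (ys @ [d])"
    and fin: "\<tau> = (F xs)(v := Atom, x := Atom)" "G xs + 5 + expr_cost e \<le> U"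
  shows "runs (foreach x v e c) \<sigma> U \<tau>"
proof -
  have "\<exists>b. runs
      (While (Var v) (Seq (Assign x (Hd (Var v))) (Seq (Assign v (Tl (Var v))) c)))
      ((F [])(v := enc_list (map en xs), x := \<sigma> x)) (G xs - G [] + 2) ((F xs)(v := Atom, x := b))"
    by (rule runs_foreach_loop[where T=T, OF assms(1)]) (use body in \<open>simp del: fun_upd_apply\<close>, use G in simp_all)
  then obtain b where b: "runs
      (While (Var v) (Seq (Assign x (Hd (Var v))) (Seq (Assign v (Tl (Var v))) c)))
      ((F [])(v := enc_list (map en xs), x := \<sigma> x)) (G xs - G [] + 2) ((F xs)(v := Atom, x := b))" ..
  show ?thesis unfolding foreach_def
    apply (rule runs_Seq[where T="Suc (expr_cost e)" and U="G xs - G [] + 4"])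
      apply (rule runs_Assign, rule refl, simp)
     apply (rule runs_Seq[where T="G xs - G [] + 2" and U=2])
       apply (use b assms(1,2,3) in \<open>simp add: fun_upd_idem\<close>)
       apply (rule runs_Assign)
    using assms(1) fin by auto
qed

lemma runs_foreach:
  assumes "x \<noteq> v" "eval_expr e \<sigma> = enc_list (map en xs)" "F [] = \<sigma>"
    and body: "\<And>ys d zs. xs = ys @ d # zs \<Longrightarrow>
      runs c ((F ys)(v := enc_list (map en zs), x := en d)) (T d)
        ((F (ys @ [d]))(v := enc_list (map en zs), x := en d))"
    and fin: "\<tau> = (F xs)(v := Atom, x := Atom)"
      "(\<Sum>d\<leftarrow>xs. T d + 8) + 5 + expr_cost e \<le> U"
  shows "runs (foreach x v e c) \<sigma> U \<tau>"
  by (rule runs_foreach_gen[where F=F and T="\<lambda>_. T" and G="\<lambda>ys. \<Sum>d\<leftarrow>ys. T d + 8", OF assms(1-3)])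
    (use body fin in auto)

text \<open>The pattern of most loops below: each round pushes a block \<open>h d\<close> in front
  of an accumulator, so the blocks end up in reverse order. The body has to work for every
  accumulator \<open>ds\<close> and every content \<open>a\<close> of the list register, because
  neither is fixed in the middle of the loop.\<close>

lemma runs_collect_map:
  assumes "distinct [x, v, acc]" "eval_expr e \<sigma> = enc_list (map en xs)"
    and "\<sigma> acc = enc_list (map ea ds)" "\<sigma> x = Atom" "\<sigma> v = Atom"
    and body: "\<And>d ds a. d \<in> set xs \<Longrightarrow>
      runs c (\<sigma>(acc := enc_list (map ea ds), v := a, x := en d)) (T d)
        (\<sigma>(acc := enc_list (map ea (h d @ ds)), v := a, x := en d))"
    and fin: "\<tau> = \<sigma>(acc := enc_list (map ea (concat (rev (map h xs)) @ ds)))"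
      "(\<Sum>d\<leftarrow>xs. T d + 8) + 5 + expr_cost e \<le> U"
  shows "runs (foreach x v e c) \<sigma> U \<tau>"
proof (rule runs_foreach[where F="\<lambda>ys. \<sigma>(acc := enc_list (map ea (concat (rev (map h ys)) @ ds)))"
      and T=T])
  fix ys d zs assume "xs = ys @ d # zs"
  then show "runs c (\<sigma>(acc := enc_list (map ea (concat (rev (map h ys)) @ ds)),
      v := enc_list (map en zs), x := en d)) (T d)
      (\<sigma>(acc := enc_list (map ea (concat (rev (map h (ys @ [d]))) @ ds)),
      v := enc_list (map en zs), x := en d))"
    using body[of d "concat (rev (map h ys)) @ ds"] by simp
qed (use assms in \<open>auto simp: fun_eq_iff\<close>)

lemmas runs_collect = runs_collect_map[where ea="\<lambda>x. x", unfolded list.map_ident]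

section \<open>Relocating programs to fresh registers and calling them\<close>

fun shift_expr :: "nat \<Rightarrow> expr \<Rightarrow> expr" where
  "shift_expr n (Var i) = Var (n + i)"
| "shift_expr n NilE = NilE"
| "shift_expr n (ConsE a b) = ConsE (shift_expr n a) (shift_expr n b)"
| "shift_expr n (Hd a) = Hd (shift_expr n a)"
| "shift_expr n (Tl a) = Tl (shift_expr n a)"

fun shift_prog :: "nat \<Rightarrow> prog \<Rightarrow> prog" where
  "shift_prog n (Assign i e) = Assign (n + i) (shift_expr n e)"
| "shift_prog n (Seq c d) = Seq (shift_prog n c) (shift_prog n d)"
| "shift_prog n (If e c d) = If (shift_expr n e) (shift_prog n c) (shift_prog n d)"
| "shift_prog n (While e c) = While (shift_expr n e) (shift_prog n c)"

text \<open>Only assigned variables count: one that is merely read keeps its value and requires no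
  clean-up after a call.\<close>

fun var_bound :: "prog \<Rightarrow> nat" where
  "var_bound (Assign i e) = i"
| "var_bound (Seq c d) = max (var_bound c) (var_bound d)"
| "var_bound (If e c d) = max (var_bound c) (var_bound d)"
| "var_bound (While e c) = var_bound c"

definition join_store :: "nat \<Rightarrow> store \<Rightarrow> store \<Rightarrow> store" where
  "join_store n \<rho> \<sigma> = (\<lambda>i. if i < n then \<rho> i else \<sigma> (i - n))"

lemma shift_expr_cost [simp]: "expr_cost (shift_expr n e) = expr_cost e"
  by (induction e) auto

lemma eval_shift_expr [simp]: "eval_expr (shift_expr n e) (join_store n \<rho> \<sigma>) = eval_expr e \<sigma>"
  by (induction e) (auto simp: join_store_def)

text \<open>Renaming the variables preserves the size of expressions, hence the exact number of
  steps, and the shifted program never touches the caller's part \<open>\<rho>\<close> below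
  \<open>n\<close>.\<close>

lemma exec_shift:
  "exec c \<sigma> t \<tau> \<Longrightarrow> exec (shift_prog n c) (join_store n \<rho> \<sigma>) t (join_store n \<rho> \<tau>)"
proof (induction rule: exec.induct)
  case (exec_Assign i e \<sigma>)
  have eq: "join_store n \<rho> (\<sigma>(i := eval_expr e \<sigma>)) =
      (join_store n \<rho> \<sigma>)(n + i := eval_expr (shift_expr n e) (join_store n \<rho> \<sigma>))"
    unfolding eval_shift_expr by (auto simp: join_store_def fun_eq_iff)
  show ?case
    unfolding shift_prog.simps eq
    using exec.exec_Assign[of "n + i" "shift_expr n e"] unfolding shift_expr_cost by blast
next
  case (exec_If_true e \<sigma> c t \<tau> d)
  then show ?case using exec.exec_If_true[of "shift_expr n e" "join_store n \<rho> \<sigma>"] by simp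
next
  case (exec_If_false e \<sigma> d t \<tau> c)
  then show ?case using exec.exec_If_false[of "shift_expr n e" "join_store n \<rho> \<sigma>"] by simp
next
  case (exec_While_false e \<sigma> c)
  then show ?case using exec.exec_While_false[of "shift_expr n e" "join_store n \<rho> \<sigma>"] by simp
next
  case (exec_While_true e \<sigma> c t \<tau> u \<upsilon>)
  then show ?case using exec.exec_While_true[of "shift_expr n e" "join_store n \<rho> \<sigma>"] by simp
qed (auto intro: exec.exec_Seq)

lemma exec_var_bound: "exec c \<sigma> t \<tau> \<Longrightarrow> i > var_bound c \<Longrightarrow> \<tau> i = \<sigma> i"
  by (induction rule: exec.induct) auto

fun reset_vars :: "nat \<Rightarrow> nat \<Rightarrow> prog" where
  "reset_vars n 0 = Assign n NilE"
| "reset_vars n (Suc b) = Seq (reset_vars n b) (Assign (n + Suc b) NilE)"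

lemma runs_reset_vars:
  "runs (reset_vars n b) \<sigma> (2 * b + 2) (\<lambda>i. if n \<le> i \<and> i \<le> n + b then Atom else \<sigma> i)"
proof (induction b)
  case 0
  show ?case unfolding reset_vars.simps by (rule runs_Assign) auto
next
  case (Suc b)
  show ?case unfolding reset_vars.simps
    by (rule runs_Seq[OF Suc, where U=2], rule runs_Assign) auto
qed

definition call :: "nat \<Rightarrow> prog \<Rightarrow> expr \<Rightarrow> nat \<Rightarrow> prog" where
  "call n c e i = Seq (Assign n e) (Seq (shift_prog n c)
     (Seq (Assign i (Var n)) (reset_vars n (var_bound c))))"

text \<open>\<open>computes_within\<close> speaks only about stores that are \<open>Atom\<close>
  apart from the input, so all registers from \<open>n\<close> on must be \<open>Atom\<close> before
  the call, and \<open>reset_vars\<close> restores this for the next one. The clean-up time depends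
  on the program \<open>c\<close> alone and so stays constant in inner loops.\<close>

lemma runs_call:
  assumes "computes_within c inp out T" "eval_expr e \<sigma> = inp"
    and "\<And>i. n \<le> i \<Longrightarrow> \<sigma> i = Atom" "i < n"
    and "\<tau> = \<sigma>(i := out)" "T + expr_cost e + 2 * var_bound c + 5 \<le> U"
  shows "runs (call n c e i) \<sigma> U \<tau>"
proof -
  obtain t \<rho> where t: "exec c ((\<lambda>_. Atom)(0 := inp)) t \<rho>" "\<rho> 0 = out" "t \<le> T"
    using assms(1) unfolding computes_within_def by blast
  have eq: "join_store n \<sigma> ((\<lambda>_. Atom)(0 := inp)) = \<sigma>(n := inp)"
    using assms(3) by (auto simp: join_store_def fun_eq_iff)
  have c: "runs (shift_prog n c) (\<sigma>(n := inp)) T (join_store n \<sigma> \<rho>)"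
    using exec_shift[OF t(1), of n \<sigma>] t(3) unfolding eq runs_def by blast
  have fin: "(\<lambda>j. if n \<le> j \<and> j \<le> n + var_bound c then Atom
      else ((join_store n \<sigma> \<rho>)(i := out)) j) = \<tau>"
    using exec_var_bound[OF t(1)] assms(3,4,5) by (auto simp: join_store_def fun_eq_iff)
  show ?thesis unfolding call_def
    apply (rule runs_Seq[where T="Suc (expr_cost e)" and U="T + (2 + (2 * var_bound c + 2))"])
      apply (rule runs_Assign, rule refl, simp)
     apply (rule runs_Seq[where T="T" and U="2 + (2 * var_bound c + 2)"])
       apply (use c assms(2) in simp)
      apply (rule runs_Seq[where T="2" and U="2 * var_bound c + 2"])
        apply (rule runs_Assign, rule refl, simp)
       apply (use runs_reset_vars[of n "var_bound c" "(join_store n \<sigma> \<rho>)(i := out)"] fin t(2)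
        in \<open>simp add: join_store_def cong: if_cong\<close>)
    using assms by auto
qed

section \<open>Bit strings\<close>

lemma runs_Assign_exact: "runs (Assign i e) \<sigma> (Suc (expr_cost e)) (\<sigma>(i := eval_expr e \<sigma>))"
  by (rule runs_Assign) simp_all

lemma runs_Assign_eq:
  "\<tau> = \<sigma>(i := eval_expr e \<sigma>) \<Longrightarrow> runs (Assign i e) \<sigma> (Suc (expr_cost e)) \<tau>"
  by (rule runs_Assign) simp_all

lemma enc_list_eq_Atom [simp]: "enc_list xs = Atom \<longleftrightarrow> xs = []"
  by (cases xs) auto

lemma enc_bits_simps [simp]:
  "enc_bits [] = Atom" "enc_bits (b # x) = Pair (enc_bool b) (enc_bits x)"
  by (simp_all add: enc_bits_def)

lemma enc_bool_eq_Atom [simp]: "enc_bool b = Atom \<longleftrightarrow> \<not> b"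
  by (cases b) auto

lemma enc_list_eq_iff: "enc_list xs = enc_list ys \<longleftrightarrow> xs = ys"
proof (induction xs arbitrary: ys)
  case Nil
  then show ?case by (cases ys) auto
next
  case (Cons x xs)
  then show ?case by (cases ys) auto
qed

lemma enc_bool_eq_iff [simp]: "enc_bool a = enc_bool b \<longleftrightarrow> a = b"
  by (cases a; cases b) auto

lemma enc_bits_eq_iff [simp]: "enc_bits x = enc_bits y \<longleftrightarrow> x = y"
  unfolding enc_bits_def enc_list_eq_iff by (simp add: inj_map_eq_map inj_def)

section \<open>Comparison of bit strings up to the first difference\<close>

fun common_prefix :: "bits \<Rightarrow> bits \<Rightarrow> nat" where
  "common_prefix (a # x) (b # y) = (if a = b then Suc (common_prefix x y) else 0)"
| "common_prefix _ _ = 0"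

text \<open>A mismatch empties both strings and thereby ends the loop at once; this early exit makes
  the cost depend on the common prefix only.\<close>

definition equal_loop :: "nat \<Rightarrow> nat \<Rightarrow> nat \<Rightarrow> prog" where
  "equal_loop a b c =
    (let advance = Seq (Assign a (Tl (Var a))) (Assign b (Tl (Var b)));
         reject = Seq (Assign a NilE) (Seq (Assign b NilE) (Assign c NilE))
     in While (Var a) (If (Hd (Var a)) (If (Hd (Var b)) advance reject)
          (If (Hd (Var b)) reject advance)))"

text \<open>A round takes 14 steps whether the bits agree or not, and a mismatch is followed by the
  failing test, hence 16. Equal lengths matter because \<open>a\<close> alone controls the loop: a
  leftover in \<open>b\<close> would go unnoticed.\<close>

lemma runs_equal_loop:
  assumes "distinct [a, b, c]"
  shows "length x = length y \<Longrightarrow> \<sigma> a = enc_bits x \<Longrightarrow> \<sigma> b = enc_bits y \<Longrightarrow>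
    \<sigma> c = enc_bool True \<Longrightarrow> \<tau> = \<sigma>(a := Atom, b := Atom, c := enc_bool (x = y)) \<Longrightarrow>
    runs (equal_loop a b c) \<sigma> (14 * common_prefix x y + 16) \<tau>"
proof (induction x y arbitrary: \<sigma> rule: list_induct2')
  case 1
  then show ?case unfolding equal_loop_def Let_def
    by (intro runs_While_false) (auto simp: fun_eq_iff)
next
  case (4 d x e y)
  let ?advance = "Seq (Assign a (Tl (Var a))) (Assign b (Tl (Var b)))"
  let ?reject = "Seq (Assign a NilE) (Seq (Assign b NilE) (Assign c NilE))"
  let ?body = "If (Hd (Var a)) (If (Hd (Var b)) ?advance ?reject) (If (Hd (Var b)) ?reject ?advance)"
  have advance: "runs ?advance \<sigma> 6 (\<sigma>(a := enc_bits x, b := enc_bits y))"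
    by (rule runs_Seq, rule runs_Assign_exact, rule runs_Assign_eq)
      (use "4.prems" assms in \<open>auto simp: fun_eq_iff\<close>)
  have reject: "runs ?reject \<sigma> 6 (\<sigma>(a := Atom, b := Atom, c := Atom))"
    by (rule runs_Seq, rule runs_Assign_exact, rule runs_Seq, rule runs_Assign_exact,
        rule runs_Assign_eq, auto)
  show ?case
  proof (cases "d = e")
    case True
    have 1: "runs ?body \<sigma> 12 (\<sigma>(a := enc_bits x, b := enc_bits y))"
      by (rule runs_If[where T=9]; (rule runs_If[where T=6])?) (use advance "4.prems" True in auto)
    have 2: "runs (equal_loop a b c) (\<sigma>(a := enc_bits x, b := enc_bits y))
        (14 * common_prefix x y + 16) \<tau>"
      by (rule "4.IH") (use "4.prems" assms True in \<open>auto simp: fun_eq_iff\<close>)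
    show ?thesis
      unfolding equal_loop_def Let_def
      by (rule runs_While_true[OF _ 1 2[unfolded equal_loop_def Let_def]])
        (use "4.prems" True in auto)
  next
    case False
    have 1: "runs ?body \<sigma> 12 (\<sigma>(a := Atom, b := Atom, c := Atom))"
      by (rule runs_If[where T=9]; (rule runs_If[where T=6])?) (use reject "4.prems" False in auto)
    show ?thesis
      unfolding equal_loop_def Let_def
      by (rule runs_While_true[OF _ 1 runs_While_false[OF _ _ order_refl]])
        (use "4.prems" False assms in auto)
  qed
qed auto

definition equal_prog :: "nat \<Rightarrow> nat \<Rightarrow> nat \<Rightarrow> prog" where
  "equal_prog a b c = Seq (Assign c (ConsE NilE NilE)) (equal_loop a b c)"

lemma runs_equal_prog:
  assumes "distinct [a, b, c]" "length x = length y" "\<sigma> a = enc_bits x" "\<sigma> b = enc_bits y"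
    and "\<tau> = \<sigma>(a := Atom, b := Atom, c := enc_bool (x = y))"
  shows "runs (equal_prog a b c) \<sigma> (14 * common_prefix x y + 20) \<tau>"
  unfolding equal_prog_def
  by (rule runs_Seq, rule runs_Assign_exact, rule runs_equal_loop[OF assms(1,2)])
    (use assms in \<open>auto simp: fun_eq_iff\<close>)

section \<open>Binary counter with constant amortised cost\<close>

fun incr :: "bits \<Rightarrow> bits" where
  "incr [] = [True]"
| "incr (b # x) = (if b then False # incr x else True # x)"

text \<open>The least significant bit comes first, so the trailing ones of the number stand at the
  head of the list; they are the positions that a carry runs through.\<close>

fun trailing_ones :: "bits \<Rightarrow> nat" where
  "trailing_ones [] = 0"
| "trailing_ones (b # x) = (if b then Suc (trailing_ones x) else 0)"

fun ones :: "bits \<Rightarrow> nat" where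
  "ones [] = 0"
| "ones (b # x) = of_bool b + ones x"

text \<open>The classical potential of a binary counter: an increment destroys the trailing ones and
  creates a single new one.\<close>

lemma ones_incr: "ones (incr x) + trailing_ones x = ones x + 1"
  by (induction x) auto

lemma binary_Suc: "binary (Suc n) = incr (binary n)"
proof (induction n rule: less_induct)
  case (less n)
  show ?case
  proof (cases "n = 0")
    case True
    then show ?thesis by (simp add: binary.simps)
  next
    case False
    have bn: "binary n = odd n # binary (n div 2)" and
      bS: "binary (Suc n) = odd (Suc n) # binary (Suc n div 2)"
      using False by (simp_all add: binary.simps[of n] binary.simps[of "Suc n"])
    show ?thesis
    proof (cases "odd n")
      case True
      then have "Suc n div 2 = Suc (n div 2)" by presburger
      then show ?thesis using bn bS True less[of "n div 2"] False by simp
    next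
      case False
      then have "Suc n div 2 = n div 2" by presburger
      then show ?thesis using bn bS False by simp
    qed
  qed
qed

text \<open>Horner evaluation is a left inverse of \<open>binary\<close>. The injectivity is needed
  where numbers in binary tag the right nodes.\<close>

lemma binary_eq_iff: "binary i = binary j \<longleftrightarrow> i = j"
proof -
  have "foldr (\<lambda>b n. of_bool b + 2 * n) (binary n) 0 = n" for n :: nat
  proof (induction n rule: less_induct)
    case (less n)
    show ?case by (subst binary.simps) (use less[of "n div 2"] in \<open>auto\<close>)
  qed
  then show ?thesis by metis
qed

text \<open>\<open>Hd\<close> of \<open>Atom\<close> is \<open>Atom\<close>, so the test also stops
  at the end of the string, where the carry makes the number one bit longer. The ones passed over
  are recorded in \<open>u\<close> as the zeros that replace them.\<close>

definition carry_loop :: "nat \<Rightarrow> nat \<Rightarrow> prog" where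
  "carry_loop j u = While (Hd (Var j))
    (Seq (Assign u (ConsE NilE (Var u))) (Assign j (Tl (Var j))))"

lemma runs_carry_loop:
  assumes "j \<noteq> u"
  shows "\<sigma> j = enc_bits x \<Longrightarrow> \<sigma> u = enc_bits (replicate n False) \<Longrightarrow>
    \<tau> = \<sigma>(j := enc_bits (drop (trailing_ones x) x),
          u := enc_bits (replicate (n + trailing_ones x) False)) \<Longrightarrow>
    runs (carry_loop j u) \<sigma> (10 * trailing_ones x + 3) \<tau>"
proof (induction x arbitrary: \<sigma> n)
  case Nil
  then show ?case unfolding carry_loop_def by (intro runs_While_false) (auto simp: fun_eq_iff)
next
  case (Cons b x)
  show ?case
  proof (cases b)
    case True
    let ?\<sigma> = "\<sigma>(u := enc_bits (replicate (Suc n) False), j := enc_bits x)"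
    have 1: "runs (Seq (Assign u (ConsE NilE (Var u))) (Assign j (Tl (Var j)))) \<sigma> 7 ?\<sigma>"
      by (rule runs_Seq, rule runs_Assign_exact, rule runs_Assign_eq)
        (use Cons.prems assms in \<open>auto simp: fun_eq_iff\<close>)
    have 2: "runs (carry_loop j u) ?\<sigma> (10 * trailing_ones x + 3) \<tau>"
      by (rule Cons.IH[where n="Suc n"]) (use Cons.prems assms True in \<open>auto simp: fun_eq_iff\<close>)
    show ?thesis unfolding carry_loop_def
      by (rule runs_While_true[OF _ 1 2[unfolded carry_loop_def]]) (use Cons.prems True in auto)
  next
    case False
    then show ?thesis using Cons.prems unfolding carry_loop_def
      by (intro runs_While_false) (auto simp: fun_eq_iff)
  qed
qed

text \<open>The shape in which the program assembles the result: the zeros from \<open>u\<close>, a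
  new one, and the bits above. If all bits are ones, \<open>tl [] = []\<close> accounts for the
  carry out of the top.\<close>

lemma incr_conv:
  "incr x = replicate (trailing_ones x) False @ True # tl (drop (trailing_ones x) x)"
  by (induction x) auto

definition incr_prog :: "nat \<Rightarrow> nat \<Rightarrow> nat \<Rightarrow> nat \<Rightarrow> prog" where
  "incr_prog j u y v = Seq (carry_loop j u)
    (Seq (Assign j (ConsE (ConsE NilE NilE) (Tl (Var j))))
      (Seq (foreach y v (Var u) (Assign j (ConsE NilE (Var j)))) (Assign u NilE)))"

lemma dsnd_enc_bits [simp]: "dsnd (enc_bits x) = enc_bits (tl x)"
  by (cases x) auto

lemma runs_incr_prog:
  assumes "distinct [j, u, y, v]" "\<sigma> j = enc_bits x" "\<sigma> u = Atom" "\<sigma> y = Atom" "\<sigma> v = Atom"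
    and "\<tau> = \<sigma>(j := enc_bits (incr x))"
  shows "runs (incr_prog j u y v) \<sigma> (22 * trailing_ones x + 18) \<tau>"
proof -
  let ?t = "trailing_ones x"
  let ?F = "\<lambda>n. \<sigma>(j := enc_bits (replicate n False @ True # tl (drop ?t x)),
      u := enc_bits (replicate ?t False))"
  have 1: "runs (carry_loop j u) \<sigma> (10 * ?t + 3)
      (\<sigma>(j := enc_bits (drop ?t x), u := enc_bits (replicate ?t False)))"
    by (rule runs_carry_loop[where n=0]) (use assms in auto)
  have 2: "runs (foreach y v (Var u) (Assign j (ConsE NilE (Var j)))) (?F 0) (12 * ?t + 6) (?F ?t)"
  proof (rule runs_foreach[where xs="replicate ?t False" and en=enc_bool and T="\<lambda>_. 4" and
        F="\<lambda>ys. ?F (length ys)"])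
    fix ys d zs assume "replicate ?t False = ys @ d # zs"
    then have "d \<in> set (replicate ?t False)" by simp
    then have "\<not> d" by simp
    then show "runs (Assign j (ConsE NilE (Var j)))
        ((?F (length ys))(v := enc_list (map enc_bool zs), y := enc_bool d)) 4
        ((?F (length (ys @ [d])))(v := enc_list (map enc_bool zs), y := enc_bool d))"
      using assms by (intro runs_Assign) (auto simp: fun_eq_iff)
  next
    show "eval_expr (Var u) (?F 0) = enc_list (map enc_bool (replicate ?t False))"
      by (simp add: enc_bits_def)
    show "?F ?t = (?F (length (replicate ?t False)))(v := Atom, y := Atom)"
      using assms by (auto simp: fun_eq_iff)
  qed (use assms in \<open>auto simp: sum_list_replicate\<close>)
  have 3: "runs (Seq (foreach y v (Var u) (Assign j (ConsE NilE (Var j)))) (Assign u NilE))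
      (?F 0) (12 * ?t + 8) \<tau>"
    by (rule runs_Seq[OF 2], rule runs_Assign_eq)
      (use assms in \<open>simp_all add: fun_upd_twist fun_upd_idem flip: incr_conv\<close>)
  have 4: "runs (Assign j (ConsE (ConsE NilE NilE) (Tl (Var j))))
      (\<sigma>(j := enc_bits (drop ?t x), u := enc_bits (replicate ?t False))) 7 (?F 0)"
    by (rule runs_Assign) (use assms in \<open>auto simp: fun_eq_iff\<close>)
  show ?thesis unfolding incr_prog_def
    by (rule runs_Seq[OF 1], rule runs_Seq[OF 4 3], rule order_refl, simp)
qed

text \<open>Accumulating loops deliver their results backwards; this restores the order where the
  specification fixes it.\<close>

definition reverse_prog :: "nat \<Rightarrow> nat \<Rightarrow> nat \<Rightarrow> nat \<Rightarrow> prog" where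
  "reverse_prog x v a b = foreach x v (Var a) (Assign b (ConsE (Var x) (Var b)))"

lemma runs_reverse_prog:
  assumes "distinct [x, v, a, b]" "\<sigma> a = enc_list ds" "\<sigma> x = Atom" "\<sigma> v = Atom" "\<sigma> b = Atom"
    and "\<tau> = \<sigma>(b := enc_list (rev ds))"
  shows "runs (reverse_prog x v a b) \<sigma> (12 * length ds + 6) \<tau>"
  unfolding reverse_prog_def
proof (rule runs_collect[where xs=ds and ds="[]" and en="\<lambda>x. x" and T="\<lambda>_. 4" and h="\<lambda>x. [x]"])
  have "concat (rev (map (\<lambda>x. [x]) zs)) = rev zs" for zs :: "data list" by (induction zs) auto
  then show "\<tau> = \<sigma>(b := enc_list (concat (rev (map (\<lambda>x. [x]) ds)) @ []))"
    using assms by simp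
qed (use assms in \<open>auto intro!: runs_Assign simp: fun_eq_iff sum_list_triv\<close>)

section \<open>Tuples, numberings and right super-nodes\<close>

lemma concat_rev_map: "concat (rev (map h xs)) = rev (concat (map (\<lambda>x. rev (h x)) xs))"
  by (induction xs) auto

lemma concat_rev_singletons: "concat (rev (map (\<lambda>x. [h x]) xs)) = rev (map h xs)"
  by (induction xs) auto

section \<open>Enumeration of all tuples over an alphabet\<close>

definition tuples_step :: "nat \<Rightarrow> nat \<Rightarrow> prog" where
  "tuples_step a b = foreach 12 13 (Var b)
     (foreach 14 15 (Var a) (Assign 16 (ConsE (ConsE (Var 14) (Var 12)) (Var 16))))"

lemma runs_tuples_step:
  assumes "a \<notin> {10..16}" "b \<notin> {10..16}" "a \<noteq> b"
    and "\<sigma> b = enc_list (map enc_list S)" "\<sigma> a = enc_list L" "\<And>i. i \<in> {12..16} \<Longrightarrow> \<sigma> i = Atom"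
    and "\<tau> = \<sigma>(16 := enc_list (rev (map enc_list (concat (map (\<lambda>s. map (\<lambda>y. y # s) L) S)))))"
  shows "runs (tuples_step a b) \<sigma> (length S * (14 * length L + 14) + 6) \<tau>"
  unfolding tuples_step_def
proof (rule runs_collect[where xs=S and en=enc_list and acc=16 and ds="[]" and
      T="\<lambda>_. 14 * length L + 6" and h="\<lambda>s. rev (map (\<lambda>y. enc_list (y # s)) L)"])
  fix d ds c
  assume "d \<in> set S"
  show "runs (foreach 14 15 (Var a) (Assign 16 (ConsE (ConsE (Var 14) (Var 12)) (Var 16))))
     (\<sigma>(16 := enc_list ds, 13 := c, 12 := enc_list d)) (14 * length L + 6)
     (\<sigma>(16 := enc_list (rev (map (\<lambda>y. enc_list (y # d)) L) @ ds), 13 := c, 12 := enc_list d))"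
    by (rule runs_collect[where xs=L and en="\<lambda>x. x" and acc=16 and ds="ds" and
          T="\<lambda>_. 6" and h="\<lambda>y. [enc_list (y # d)]"])
      (use assms in \<open>auto intro!: runs_Assign simp: fun_eq_iff concat_rev_singletons
        sum_list_replicate map_replicate_const\<close>)
qed (use assms in \<open>auto simp: concat_rev_map map_concat comp_def sum_list_replicate
        map_replicate_const\<close>)

text \<open>The list \<open>u\<close> is a unary counter: its elements are ignored and its length is
  the length of the tuples. For message tuples the listing of the sets itself serves as the counter,
  which avoids decoding \<open>k\<close> from binary.\<close>

definition tuples_prog :: "expr \<Rightarrow> nat \<Rightarrow> nat \<Rightarrow> prog" where
  "tuples_prog u a b = Seq (Assign b (ConsE NilE NilE)) (foreach 10 11 u
     (Seq (tuples_step a b) (Seq (Assign b NilE) (Seq (reverse_prog 12 13 16 b) (Assign 16 NilE)))))"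

text \<open>The sum of powers stays unevaluated because its size depends on the alphabet: with at
  least two letters it is at most twice its last term, with one letter it is
  \<open>length us\<close>.\<close>

lemma runs_tuples_prog:
  assumes "a \<notin> {10..16}" "b \<notin> {10..16}" "a \<noteq> b" "\<And>d. eval_expr u (\<sigma>(b := d)) = enc_list us"
    and L: "\<sigma> a = enc_list L" "L \<noteq> []" and scratch: "\<And>i. i \<in> {10..16} \<Longrightarrow> \<sigma> i = Atom"
    and "\<tau> = \<sigma>(b := enc_list (map enc_list (List.n_lists (length us) L)))"
    and "64 * (\<Sum>i<length us. length L ^ Suc i) + expr_cost u + 9 \<le> T"
  shows "runs (tuples_prog u a b) \<sigma> T \<tau>"
proof -
  let ?F = "\<lambda>ys :: data list. \<sigma>(b := enc_list (map enc_list (List.n_lists (length ys) L)))"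
  have len: "length L \<ge> 1" using L by (cases L) auto
  have loop: "runs (foreach 10 11 u (Seq (tuples_step a b) (Seq (Assign b NilE)
      (Seq (reverse_prog 12 13 16 b) (Assign 16 NilE))))) (?F [])
      (64 * (\<Sum>i<length us. length L ^ Suc i) + expr_cost u + 5) (?F us)"
  proof (rule runs_foreach_gen[where F="?F" and xs=us and en="\<lambda>x. x" and
      T="\<lambda>ys _. 56 * length L ^ Suc (length ys)" and G="\<lambda>ys. 64 * (\<Sum>i<length ys. length L ^ Suc i)"])
    fix ys zs :: "data list" and d :: data
    let ?S = "List.n_lists (length ys) L"
    let ?S' = "List.n_lists (Suc (length ys)) L"
    let ?\<sigma> = "(?F ys)(11 := enc_list (map (\<lambda>x. x) zs), 10 := d)"
    have 1: "runs (tuples_step a b) ?\<sigma> (length ?S * (14 * length L + 14) + 6)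
        (?\<sigma>(16 := enc_list (rev (map enc_list ?S'))))"
      by (rule runs_tuples_step) (use assms in auto)
    have 2: "runs (Seq (Assign b NilE) (Seq (reverse_prog 12 13 16 b) (Assign 16 NilE)))
        (?\<sigma>(16 := enc_list (rev (map enc_list ?S')))) (2 + (12 * length ?S' + 6 + 2))
        ((?F (ys @ [d]))(11 := enc_list (map (\<lambda>x. x) zs), 10 := d))"
      apply (rule runs_Seq, rule runs_Assign_exact, rule runs_Seq)
         apply (rule runs_reverse_prog[where ds="rev (map enc_list ?S')"])
              apply (use assms in auto)[5]
         apply (rule refl)
        apply (rule runs_Assign_eq)
        apply (use assms in \<open>auto simp: fun_eq_iff\<close>)
      done
    have "length ?S * (14 * length L + 14) + 6 + (2 + (12 * length ?S' + 6 + 2)) \<le>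
        56 * length L ^ Suc (length ys)"
    proof -
      \<comment> \<open>Extending \<open>a\<close> tuples to \<open>b = a * length L\<close> tuples
        takes \<open>26 * b + 14 * a + 16\<close> steps including the reversal. As
        \<open>a \<le> b\<close> and \<open>1 \<le> b\<close>, this is at most
        \<open>56 * b\<close>; the loop overhead of 8 then gives the factor 64.\<close>
      define a b where "a = length ?S" and "b = length ?S'"
      have "a * length L = b" "b = length L ^ Suc (length ys)"
        unfolding a_def b_def length_n_lists by simp_all
      moreover have "a \<le> b" "1 \<le> b"
        unfolding a_def b_def length_n_lists using len by auto
      moreover have "a * (14 * length L + 14) = 14 * (a * length L) + 14 * a"
        by (simp add: algebra_simps)
      ultimately show ?thesis unfolding a_def[symmetric] b_def[symmetric] by linarith
    qed
    with 1 2 show "runs (Seq (tuples_step a b) (Seq (Assign b NilE)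
        (Seq (reverse_prog 12 13 16 b) (Assign 16 NilE)))) ?\<sigma> (56 * length L ^ Suc (length ys))
        ((?F (ys @ [d]))(11 := enc_list (map (\<lambda>x. x) zs), 10 := d))"
      by (rule runs_Seq)
  next
    fix ys :: "data list" and d
    have "1 \<le> length L ^ Suc (length ys)" using len by auto
    then show "64 * (\<Sum>i<length ys. length L ^ Suc i) + 56 * length L ^ Suc (length ys) + 8
        \<le> 64 * (\<Sum>i<length (ys @ [d]). length L ^ Suc i)" by simp
  qed (use assms in \<open>auto simp: fun_eq_iff\<close>)
  show ?thesis unfolding tuples_prog_def
    by (rule runs_Seq, rule runs_Assign_exact) (use loop assms in auto)
qed

section \<open>Numbering the sets by their players\<close>

definition numbered :: "'a list \<Rightarrow> (nat \<times> 'a) list" where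
  "numbered xs = zip [0..<length xs] xs"

definition enc_numbered :: "('a \<Rightarrow> data) \<Rightarrow> nat \<times> 'a \<Rightarrow> data" where
  "enc_numbered en p = Pair (enc_bits (binary (fst p))) (en (snd p))"

definition number_prog :: "nat \<Rightarrow> nat \<Rightarrow> prog" where
  "number_prog a b = Seq (foreach 10 11 (Var a)
      (Seq (Assign 16 (ConsE (ConsE (Var 15) (Var 10)) (Var 16))) (incr_prog 15 12 13 14)))
    (Seq (Assign 15 NilE) (Seq (reverse_prog 10 11 16 b) (Assign 16 NilE)))"

text \<open>Telescoping the potential \<open>ones\<close>, which starts at 0 because
  \<open>binary 0\<close> is empty.\<close>

lemma sum_trailing_ones: "(\<Sum>i<n. trailing_ones (binary i)) \<le> n"
proof -
  have "(\<Sum>i<n. trailing_ones (binary i)) + ones (binary n) = n" for n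
  proof (induction n)
    case 0
    then show ?case by (simp add: binary.simps)
  next
    case (Suc n)
    then show ?case using ones_incr[of "binary n"] by (simp add: binary_Suc)
  qed
  then show ?thesis by (metis le_add1)
qed

lemma numbered_snoc: "numbered (ys @ [d]) = numbered ys @ [(length ys, d)]"
  by (simp add: numbered_def)

lemma length_numbered [simp]: "length (numbered ys) = length ys"
  by (simp add: numbered_def)

text \<open>A single increment may carry through the whole counter, so the loop is charged by
  accumulated carries. Each element costs 32 steps plus 22 for an amortised carry, and 12 more in
  the final reversal, 66 altogether.\<close>

lemma runs_number_prog:
  assumes "a \<notin> {10..16}" "b \<notin> {10..16}" "a \<noteq> b" "\<sigma> a = enc_list (map en xs)" "\<sigma> b = Atom"
    and scratch: "\<And>i. i \<in> {10..16} \<Longrightarrow> \<sigma> i = Atom"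
    and fin: "\<tau> = \<sigma>(b := enc_list (map (enc_numbered en) (numbered xs)))" "66 * length xs + 20 \<le> T"
  shows "runs (number_prog a b) \<sigma> T \<tau>"
proof -
  let ?en = "enc_numbered en"
  let ?F = "\<lambda>ys. \<sigma>(15 := enc_bits (binary (length ys)), 16 := enc_list (rev (map ?en (numbered ys))))"
  let ?body = "Seq (Assign 16 (ConsE (ConsE (Var 15) (Var 10)) (Var 16))) (incr_prog 15 12 13 14)"
  have loop: "runs (foreach 10 11 (Var a) ?body) \<sigma> (54 * length xs + 6) (?F xs)"
  proof (rule runs_foreach_gen[where F="?F" and xs=xs and en=en and
      T="\<lambda>ys _. 22 * trailing_ones (binary (length ys)) + 24" and
      G="\<lambda>ys. (\<Sum>i<length ys. 22 * trailing_ones (binary i) + 32)"])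
    fix ys d zs
    let ?\<sigma> = "(?F ys)(11 := enc_list (map en zs), 10 := en d)"
    have 1: "runs (Assign 16 (ConsE (ConsE (Var 15) (Var 10)) (Var 16))) ?\<sigma> 6
        (?\<sigma>(16 := enc_list (rev (map ?en (numbered (ys @ [d]))))))"
      by (rule runs_Assign) (simp_all add: numbered_snoc enc_numbered_def fun_eq_iff)
    show "runs ?body ?\<sigma> (22 * trailing_ones (binary (length ys)) + 24)
        ((?F (ys @ [d]))(11 := enc_list (map en zs), 10 := en d))"
      by (rule runs_Seq[OF 1 runs_incr_prog[where x="binary (length ys)"]])
        (use assms in \<open>auto simp: fun_eq_iff binary_Suc\<close>)
  next
    have "(\<Sum>i<length xs. 22 * trailing_ones (binary i) + 32) \<le> 54 * length xs"
      using sum_trailing_ones[of "length xs"]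
      by (simp add: sum.distrib flip: sum_distrib_left)
    then show "(\<Sum>i<length xs. 22 * trailing_ones (binary i) + 32) + 5 + expr_cost (Var a)
        \<le> 54 * length xs + 6" by simp
  next
    show "?F [] = \<sigma>" using scratch by (auto simp: fun_eq_iff binary.simps numbered_def)
    show "?F xs = (?F xs)(11 := Atom, 10 := Atom)" using scratch by (auto simp: fun_eq_iff)
  qed (use assms in auto)
  have "runs (number_prog a b) \<sigma> (54 * length xs + 6 + (2 + (12 * length xs + 6 + 2))) \<tau>"
    unfolding number_prog_def
    apply (rule runs_Seq[OF loop], rule runs_Seq, rule runs_Assign_exact, rule runs_Seq)
        apply (rule runs_reverse_prog[where ds="rev (map ?en (numbered xs))"])
             apply (use assms in auto)[5]
        apply (rule refl)
       apply (rule runs_Assign_eq)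
       apply (use assms in \<open>auto simp: fun_eq_iff\<close>)
    done
  then show ?thesis by (rule runs_mono) (use fin in simp)
qed

definition enc_set :: "bits list \<Rightarrow> data" where
  "enc_set A = enc_list (map enc_bits A)"

text \<open>The number of the player is part of the name, so that a string occurring in several sets
  yields different nodes and the super-nodes are disjoint.\<close>

definition right_node :: "nat \<Rightarrow> bits \<Rightarrow> data" where
  "right_node j x = Pair (enc_bits (binary j)) (enc_bits x)"

definition right_prog :: "nat \<Rightarrow> nat \<Rightarrow> prog" where
  "right_prog a b = foreach 10 11 (Var a)
     (Seq (foreach 12 13 (Tl (Var 10)) (Assign 14 (ConsE (ConsE (Hd (Var 10)) (Var 12)) (Var 14))))
       (Seq (Assign b (ConsE (Var 14) (Var b))) (Assign 14 NilE)))"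

text \<open>The reversals record the order in which the accumulating loops emit nodes and
  super-nodes. This order is irrelevant for the cover properties and is not corrected.\<close>

definition right_lists :: "bits list list \<Rightarrow> data list list" where
  "right_lists As = rev (map (\<lambda>p. rev (map (right_node (fst p)) (snd p))) (numbered As))"

lemma map_snd_numbered [simp]: "map snd (numbered xs) = xs"
  by (simp add: numbered_def)

lemma sum_list_numbered: "(\<Sum>p\<leftarrow>numbered xs. g (snd p)) = (\<Sum>x\<leftarrow>xs. g x)"
proof -
  have "(\<Sum>p\<leftarrow>numbered xs. g (snd p)) = sum_list (map g (map snd (numbered xs)))"
    by (simp add: comp_def del: map_snd_numbered)
  then show ?thesis by simp
qed

lemma runs_right_prog:
  assumes "a \<notin> {10..16}" "b \<notin> {10..16}" "a \<noteq> b"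
    and "\<sigma> a = enc_list (map (enc_numbered enc_set) (numbered As))" "\<sigma> b = Atom"
    and scratch: "\<And>i. i \<in> {10..16} \<Longrightarrow> \<sigma> i = Atom"
    and fin: "\<tau> = \<sigma>(b := enc_list (map enc_list (right_lists As)))"
      "(\<Sum>A\<leftarrow>As. 15 * length A + 21) + 6 \<le> T"
  shows "runs (right_prog a b) \<sigma> T \<tau>"
  unfolding right_prog_def
proof (rule runs_collect[where xs="numbered As" and en="enc_numbered enc_set" and ds="[]" and acc=b
      and T="\<lambda>p. 15 * length (snd p) + 13"
      and h="\<lambda>p. [enc_list (rev (map (right_node (fst p)) (snd p)))]"])
  fix p :: "nat \<times> bits list" and ds c
  obtain j A where p: "p = (j, A)" by (cases p)
  let ?\<sigma> = "\<sigma>(b := enc_list ds, 11 := c, 10 := enc_numbered enc_set p)"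
  have loop: "runs (foreach 12 13 (Tl (Var 10)) (Assign 14 (ConsE (ConsE (Hd (Var 10)) (Var 12)) (Var 14))))
      ?\<sigma> (15 * length A + 7) (?\<sigma>(14 := enc_list (rev (map (right_node j) A))))"
    by (rule runs_collect[where xs=A and en=enc_bits and acc=14 and ds="[]" and T="\<lambda>_. 7"
          and h="\<lambda>x. [right_node j x]"])
      (use assms p in \<open>auto intro!: runs_Assign simp: enc_numbered_def enc_set_def right_node_def[abs_def]
        concat_rev_singletons sum_list_triv fun_eq_iff\<close>)
  show "runs (Seq (foreach 12 13 (Tl (Var 10))
      (Assign 14 (ConsE (ConsE (Hd (Var 10)) (Var 12)) (Var 14))))
      (Seq (Assign b (ConsE (Var 14) (Var b))) (Assign 14 NilE)))
      ?\<sigma> (15 * length (snd p) + 13) (\<sigma>(b := enc_list ([enc_list (rev (map (right_node (fst p)) (snd p)))] @ ds),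
      11 := c, 10 := enc_numbered enc_set p))"
    by (rule runs_Seq[OF loop], rule runs_Seq[OF runs_Assign_exact runs_Assign_eq])
      (use assms p in \<open>auto simp: fun_eq_iff\<close>)
next
  have "(\<Sum>p\<leftarrow>numbered As. 15 * length (snd p) + 13 + 8) = (\<Sum>A\<leftarrow>As. 15 * length A + 21)"
    using sum_list_numbered[of "\<lambda>A. 15 * length A + 21" As] by (simp add: ac_simps)
  then show "(\<Sum>p\<leftarrow>numbered As. 15 * length (snd p) + 13 + 8) + 5 + expr_cost (Var a) \<le> T"
    using fin by simp
  show "\<tau> = \<sigma>(b := enc_list (concat (rev (map (\<lambda>p. [enc_list (rev (map (right_node (fst p)) (snd p)))])
      (numbered As))) @ []))"
    unfolding fin concat_rev_singletons right_lists_def by (simp add: rev_map comp_def)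
qed (use assms in auto)

section \<open>Programs for the label cover instances\<close>

text \<open>Naming the coins keeps the left super-nodes of different coin strings disjoint, although
  all of them draw on the same message tuples.\<close>

definition left_node :: "bits \<Rightarrow> bits list \<Rightarrow> data" where
  "left_node \<gamma> ms = Pair (enc_bits \<gamma>) (enc_list (map enc_bits ms))"

definition enc_edge :: "data \<times> data \<Rightarrow> data" where
  "enc_edge = (\<lambda>(u, v). Pair u v)"

abbreviation bit_lists :: "nat \<Rightarrow> bits list" where
  "bit_lists n \<equiv> List.n_lists n [False, True]"

lemma set_bit_lists: "set (bit_lists n) = bitstrings n"
  by (auto simp: set_n_lists bitstrings_def)

lemma length_bit_lists: "length (bit_lists n) = 2 ^ n"
  by (simp add: length_n_lists numeral_2_eq_2)

lemma numbered_mem_iff: "p \<in> set (numbered xs) \<longleftrightarrow> fst p < length xs \<and> snd p = xs ! fst p"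
proof (cases p)
  case (Pair j a)
  then show ?thesis by (auto simp: numbered_def set_zip intro!: exI[of _ j])
qed

text \<open>Register allocation: 1 holds the parameters, 4, 5 and 7 the advice strings, the coin strings
  and the message tuples, 8 the numbered sets, 9 the right super-nodes; 20, 22, 24, 27 and 31 are
  the current advice, coins, messages, numbered set and element; 37, 38 and 39 accumulate the left
  super-nodes, the edges and the instances. Subprograms use the registers from 40 on.\<close>

definition element_prog :: "prog \<Rightarrow> prog" where
  "element_prog player = Seq
     (call 40 player (ConsE (Var 1) (ConsE (Hd (Var 27)) (ConsE (Var 31) (ConsE (Var 22) NilE)))) 33)
     (Seq (Assign 34 (Hd (Var 29))) (Seq (equal_prog 33 34 35)
       (Seq (If (Var 35)
          (Assign 38 (ConsE (ConsE (ConsE (Var 22) (Var 24)) (ConsE (Hd (Var 27)) (Var 31))) (Var 38)))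
          (Assign 38 (Var 38))) (Assign 35 NilE))))"

text \<open>Register 29 holds the components not yet used and advances together with the numbered
  set in 27, so the component of the current player is always at its head. Looking it up by the
  player's number would take time growing with that number.\<close>

definition tuple_prog :: "prog \<Rightarrow> prog" where
  "tuple_prog player = Seq (Assign 29 (Var 24)) (foreach 27 28 (Var 8)
     (Seq (foreach 31 32 (Tl (Var 27)) (element_prog player)) (Assign 29 (Tl (Var 29)))))"

definition accept_prog :: "prog \<Rightarrow> prog \<Rightarrow> prog" where
  "accept_prog referee c = Seq
     (call 40 referee (ConsE (Var 1) (ConsE (Var 20) (ConsE (Var 22) (ConsE (Var 24) NilE)))) 26)
     (If (Var 26) (Seq (Assign 26 NilE) c) (Assign 26 NilE))"

definition left_prog :: "prog \<Rightarrow> prog" where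
  "left_prog referee = foreach 22 23 (Var 5)
     (Seq (foreach 24 25 (Var 7) (accept_prog referee
         (Assign 36 (ConsE (ConsE (Var 22) (Var 24)) (Var 36)))))
       (Seq (Assign 37 (ConsE (Var 36) (Var 37))) (Assign 36 NilE)))"

text \<open>The second pass over coins and tuples asks the referee again, which costs one further
  call per pair and keeps the left nodes and the edges in separate loops.\<close>

definition edge_prog :: "prog \<Rightarrow> prog \<Rightarrow> prog" where
  "edge_prog player referee = foreach 22 23 (Var 5)
     (foreach 24 25 (Var 7) (accept_prog referee (tuple_prog player)))"

definition instances_prog :: "prog \<Rightarrow> prog \<Rightarrow> prog" where
  "instances_prog player referee = foreach 20 21 (Var 4)
     (Seq (left_prog referee) (Seq (edge_prog player referee)
       (Seq (Assign 39 (ConsE (ConsE (Var 37) (ConsE (Var 9) (ConsE (Var 38) NilE))) (Var 39)))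
         (Seq (Assign 37 NilE) (Assign 38 NilE)))))"

text \<open>One instance with fixed \<open>N\<close> and \<open>k\<close>, where \<open>k\<close> is
  \<open>length As\<close> and \<open>P\<close> is the value of the time polynomial. The protocol
  enters only through its message lengths and running times: program and graph make sense for any
  \<open>acc\<close>, and completeness and soundness are used only at the very end.\<close>

locale smp_reduction =
  fixes player referee :: prog and par :: data and P m w r l :: nat
    and msg :: "nat \<Rightarrow> bits \<Rightarrow> bits \<Rightarrow> bits" and acc :: "bits \<Rightarrow> bits \<Rightarrow> bits list \<Rightarrow> bool"
    and As :: "bits list list"
  assumes sets: "\<And>A. A \<in> set As \<Longrightarrow> set A \<subseteq> bitstrings m"
    and msg: "\<And>j x \<gamma>. j < length As \<Longrightarrow> x \<in> bitstrings m \<Longrightarrow> \<gamma> \<in> bitstrings r \<Longrightarrow>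
      msg j x \<gamma> \<in> bitstrings l"
    and player: "\<And>j x \<gamma>. j < length As \<Longrightarrow> x \<in> bitstrings m \<Longrightarrow> \<gamma> \<in> bitstrings r \<Longrightarrow>
      computes_within player (enc_list [par, enc_bits (binary j), enc_bits x, enc_bits \<gamma>])
        (enc_bits (msg j x \<gamma>)) P"
    and referee: "\<And>\<mu> \<gamma> ms. \<mu> \<in> bitstrings w \<Longrightarrow> \<gamma> \<in> bitstrings r \<Longrightarrow>
      ms \<in> smp_inputs l (length As) \<Longrightarrow>
      computes_within referee
        (enc_list [par, enc_bits \<mu>, enc_bits \<gamma>, enc_list (map enc_bits ms)])
        (enc_bool (acc \<mu> \<gamma> ms)) P"
begin

definition call_time :: nat where
  "call_time = P + 2 * var_bound player + 2 * var_bound referee"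

definition tuples :: "bits list list" where
  "tuples = List.n_lists (length As) (bit_lists l)"

lemma set_tuples: "set tuples = smp_inputs l (length As)"
  unfolding tuples_def smp_inputs_def set_n_lists[of _ "bit_lists l"] set_bit_lists ..

definition element_edges :: "bits \<Rightarrow> bits list \<Rightarrow> nat \<Rightarrow> bits \<Rightarrow> bits \<Rightarrow> (data \<times> data) list" where
  "element_edges \<gamma> ms j y x = (if msg j x \<gamma> = y then [(left_node \<gamma> ms, right_node j x)] else [])"

definition set_edges :: "bits \<Rightarrow> bits list \<Rightarrow> (nat \<times> bits list) \<times> bits \<Rightarrow> (data \<times> data) list" where
  "set_edges \<gamma> ms q =
     concat (rev (map (element_edges \<gamma> ms (fst (fst q)) (snd q)) (snd (fst q))))"

definition tuple_edges :: "bits \<Rightarrow> bits list \<Rightarrow> (data \<times> data) list" where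
  "tuple_edges \<gamma> ms = concat (rev (map (set_edges \<gamma> ms) (zip (numbered As) ms)))"

definition edge_list :: "bits \<Rightarrow> (data \<times> data) list" where
  "edge_list \<mu> = concat (rev (map (\<lambda>\<gamma>. concat (rev (map
     (\<lambda>ms. if acc \<mu> \<gamma> ms then tuple_edges \<gamma> ms else []) tuples))) (bit_lists r)))"

definition left_list :: "bits \<Rightarrow> bits \<Rightarrow> data list" where
  "left_list \<mu> \<gamma> = concat (rev (map (\<lambda>ms. if acc \<mu> \<gamma> ms then [left_node \<gamma> ms] else []) tuples))"

definition left_lists :: "bits \<Rightarrow> data list list" where
  "left_lists \<mu> = rev (map (left_list \<mu>) (bit_lists r))"

definition instance_data :: "bits \<Rightarrow> data" where
  "instance_data \<mu> = enc_list [enc_list (map enc_list (left_lists \<mu>)),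
     enc_list (map enc_list (right_lists As)), enc_list (map enc_edge (edge_list \<mu>))]"

definition element_time :: "bits \<Rightarrow> nat \<Rightarrow> bits \<Rightarrow> bits \<Rightarrow> nat" where
  "element_time \<gamma> j y x = call_time + 14 * common_prefix (msg j x \<gamma>) y + 53"

definition set_time :: "bits \<Rightarrow> (nat \<times> bits list) \<Rightarrow> bits \<Rightarrow> nat" where
  "set_time \<gamma> p y = (\<Sum>x\<leftarrow>snd p. element_time \<gamma> (fst p) y x + 8) + 10"

definition tuple_time :: "bits \<Rightarrow> bits list \<Rightarrow> nat" where
  "tuple_time \<gamma> ms = (\<Sum>(p, y)\<leftarrow>zip (numbered As) ms. set_time \<gamma> p y + 8) + 8"

lemma runs_element_prog:
  assumes "p \<in> set (numbered As)" "x \<in> set (snd p)" "\<gamma> \<in> bitstrings r" "y \<in> bitstrings l"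
    and "\<sigma> 1 = par" "\<sigma> 22 = enc_bits \<gamma>" "\<sigma> 24 = enc_list (map enc_bits ms)"
    and "\<sigma> 27 = enc_numbered enc_set p" "\<sigma> 29 = enc_list (map enc_bits (y # ys))" "\<sigma> 31 = enc_bits x"
    and "\<sigma> 38 = enc_list (map enc_edge ds)" "\<And>i. i \<in> {33, 34, 35} \<union> {40..} \<Longrightarrow> \<sigma> i = Atom"
    and "\<tau> = \<sigma>(38 := enc_list (map enc_edge (element_edges \<gamma> ms (fst p) y x @ ds)))"
  shows "runs (element_prog player) \<sigma> (element_time \<gamma> (fst p) y x) \<tau>"
proof -
  let ?z = "msg (fst p) x \<gamma>"
  have j: "fst p < length As" "x \<in> bitstrings m"
    using numbered_mem_iff[THEN iffD1, OF assms(1)] assms(2) sets by force+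
  then have z: "length ?z = length y" "?z \<in> bitstrings l"
    using msg assms(3,4) by (auto simp: bitstrings_def)
  have 1: "runs (call 40 player
      (ConsE (Var 1) (ConsE (Hd (Var 27)) (ConsE (Var 31) (ConsE (Var 22) NilE)))) 33) \<sigma>
      (call_time + 15) (\<sigma>(33 := enc_bits ?z))"
    by (rule runs_call[OF player[OF j assms(3)]])
      (use assms in \<open>auto simp: enc_numbered_def call_time_def\<close>)
  \<comment> \<open>The else branch assigns register 38 to itself; this no-op matches the empty list
    in \<open>element_edges\<close>.\<close>
  have 2: "runs (If (Var 35)
        (Assign 38 (ConsE (ConsE (ConsE (Var 22) (Var 24)) (ConsE (Hd (Var 27)) (Var 31))) (Var 38)))
        (Assign 38 (Var 38))) (\<sigma>(35 := enc_bool (?z = y))) 13 (\<tau>(35 := enc_bool (?z = y)))"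
    by (rule runs_If[where T=11]; (rule runs_Assign)?)
      (use assms in \<open>auto simp: fun_eq_iff enc_edge_def element_edges_def left_node_def
        right_node_def enc_numbered_def\<close>)
  show ?thesis
    unfolding element_prog_def
    apply (rule runs_Seq[OF 1], rule runs_Seq, rule runs_Assign_exact, rule runs_Seq)
        apply (rule runs_equal_prog[where x="?z" and y=y], simp, rule z)
          apply (use assms in simp)
         apply (use assms in simp)
        apply (rule refl)
       apply (rule runs_Seq[where T=13 and U=2])
         apply (use 2 assms in \<open>simp add: fun_upd_twist fun_upd_idem\<close>)
        apply (rule runs_Assign)
    using assms by (auto simp: fun_eq_iff element_time_def)
qed

lemma runs_tuple_prog:
  assumes "\<gamma> \<in> bitstrings r" "ms \<in> set tuples"
    and "\<sigma> 1 = par" "\<sigma> 8 = enc_list (map (enc_numbered enc_set) (numbered As))"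
    and "\<sigma> 22 = enc_bits \<gamma>" "\<sigma> 24 = enc_list (map enc_bits ms)"
    and "\<sigma> 38 = enc_list (map enc_edge ds)" "\<And>i. i \<in> {27..35} \<union> {40..} \<Longrightarrow> \<sigma> i = Atom"
    and "\<tau> = \<sigma>(38 := enc_list (map enc_edge (tuple_edges \<gamma> ms @ ds)))"
  shows "runs (tuple_prog player) \<sigma> (tuple_time \<gamma> ms) \<tau>"
proof -
  have ms: "length ms = length As" "set ms \<subseteq> bitstrings l"
    using assms(2) by (auto simp: set_tuples smp_inputs_def)
  let ?xs = "zip (numbered As) ms"
  let ?en = "\<lambda>q. enc_numbered enc_set (fst q)"
  let ?F = "\<lambda>ys. \<sigma>(29 := enc_list (map enc_bits (drop (length ys) ms)),
    38 := enc_list (map enc_edge (concat (rev (map (set_edges \<gamma> ms) ys)) @ ds)))"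
  \<comment> \<open>The program loops over register 8, but the analysis runs over
    \<open>?xs\<close>, which pairs each numbered set with its message. The encoding
    \<open>?en\<close> drops the message, which the program finds at the head of register 29
    instead.\<close>
  have loop: "runs (foreach 27 28 (Var 8)
     (Seq (foreach 31 32 (Tl (Var 27)) (element_prog player)) (Assign 29 (Tl (Var 29))))) (?F [])
     (tuple_time \<gamma> ms - 2) \<tau>"
  proof (rule runs_foreach[where F="?F" and xs="?xs" and en="?en" and
        T="\<lambda>(p, y). set_time \<gamma> p y"])
    fix ys q zs
    assume xs: "?xs = ys @ q # zs"
    obtain p y where q: "q = (p, y)" by (cases q)
    have qs: "q \<in> set ?xs" using xs by simp
    then have p: "p \<in> set (numbered As)" and y: "y \<in> bitstrings l"
      using q ms(2) by (auto dest: set_zip_leftD set_zip_rightD)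
    have drop: "drop (length ys) ms = y # drop (Suc (length ys)) ms"
    proof -
      have "length ys < length ?xs" "?xs ! length ys = q" using xs by simp_all
      then have "length ys < length ms" "ms ! length ys = y" using q by auto
      then show ?thesis by (metis Cons_nth_drop_Suc)
    qed
    let ?\<sigma> = "(?F ys)(28 := enc_list (map ?en zs), 27 := ?en q)"
    let ?ds = "concat (rev (map (set_edges \<gamma> ms) ys)) @ ds"
    have 1: "runs (foreach 31 32 (Tl (Var 27)) (element_prog player)) ?\<sigma>
        ((\<Sum>x\<leftarrow>snd p. element_time \<gamma> (fst p) y x + 8) + 7)
        (?\<sigma>(38 := enc_list (map enc_edge (set_edges \<gamma> ms q @ ?ds))))"
    proof (rule runs_collect_map[where xs="snd p" and en=enc_bits and acc=38 and ea=enc_edge and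
          ds="?ds" and T="element_time \<gamma> (fst p) y" and h="element_edges \<gamma> ms (fst p) y"])
      fix x ds' c
      assume "x \<in> set (snd p)"
      then show "runs (element_prog player)
          (?\<sigma>(38 := enc_list (map enc_edge ds'), 32 := c, 31 := enc_bits x))
          (element_time \<gamma> (fst p) y x)
          (?\<sigma>(38 := enc_list (map enc_edge (element_edges \<gamma> ms (fst p) y x @ ds')),
            32 := c, 31 := enc_bits x))"
        by (rule runs_element_prog[OF p _ assms(1) y, where ys="drop (Suc (length ys)) ms"])
          (use assms q drop in \<open>auto simp: fun_eq_iff\<close>)
    qed (use assms q in \<open>auto simp: fun_eq_iff enc_numbered_def enc_set_def set_edges_def\<close>)
    show "runs (Seq (foreach 31 32 (Tl (Var 27)) (element_prog player)) (Assign 29 (Tl (Var 29)))) ?\<sigma>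
        (case q of (p, y) \<Rightarrow> set_time \<gamma> p y)
        ((?F (ys @ [q]))(28 := enc_list (map ?en zs), 27 := ?en q))"
      by (rule runs_Seq[OF 1 runs_Assign_eq])
        (use q drop in \<open>auto simp: fun_eq_iff set_time_def\<close>)
  next
    show "eval_expr (Var 8) (?F []) = enc_list (map ?en ?xs)"
    proof -
      have "map ?en ?xs = map (enc_numbered enc_set) (map fst ?xs)" by simp
      also have "map fst ?xs = numbered As" using ms(1) by simp
      finally show ?thesis using assms by simp
    qed
    show "\<tau> = (?F ?xs)(28 := Atom, 27 := Atom)"
      using assms ms by (auto simp: fun_eq_iff tuple_edges_def)
    show "(\<Sum>q\<leftarrow>?xs. (case q of (p, y) \<Rightarrow> set_time \<gamma> p y) + 8) + 5 + expr_cost (Var 8)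
        \<le> tuple_time \<gamma> ms - 2"
      by (simp add: tuple_time_def split_def)
  qed simp_all
  have "tuple_time \<gamma> ms \<ge> 2" by (simp add: tuple_time_def)
  then show ?thesis unfolding tuple_prog_def
    by (intro runs_Seq[where T=2, OF runs_Assign loop]) (use assms in \<open>auto simp: fun_eq_iff\<close>)
qed

text \<open>The time \<open>T\<close> of \<open>c\<close> is charged even if the referee rejects.
  The bound thus does not depend on \<open>acc\<close>, and averaging over all tuples remains
  possible however the accepted ones are distributed.\<close>

lemma runs_accept_prog:
  assumes "\<mu> \<in> bitstrings w" "\<gamma> \<in> bitstrings r" "ms \<in> set tuples"
    and "\<sigma> 1 = par" "\<sigma> 20 = enc_bits \<mu>" "\<sigma> 22 = enc_bits \<gamma>" "\<sigma> 24 = enc_list (map enc_bits ms)"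
    and "\<And>i. i \<in> {26} \<union> {40..} \<Longrightarrow> \<sigma> i = Atom"
    and "acc \<mu> \<gamma> ms \<Longrightarrow> runs c \<sigma> T \<tau>" "\<not> acc \<mu> \<gamma> ms \<Longrightarrow> \<tau> = \<sigma>"
  shows "runs (accept_prog referee c) \<sigma> (call_time + T + 18) \<tau>"
proof -
  let ?\<sigma> = "\<sigma>(26 := enc_bool (acc \<mu> \<gamma> ms))"
  have 1: "runs (call 40 referee (ConsE (Var 1) (ConsE (Var 20) (ConsE (Var 22) (ConsE (Var 24) NilE)))) 26)
      \<sigma> (call_time + 14) ?\<sigma>"
    by (rule runs_call[OF referee[OF assms(1,2), of ms]])
      (use assms in \<open>auto simp: call_time_def set_tuples\<close>)
  have reset: "?\<sigma>(26 := Atom) = \<sigma>" using assms by (auto simp: fun_eq_iff)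
  have 2: "runs (If (Var 26) (Seq (Assign 26 NilE) c) (Assign 26 NilE)) ?\<sigma> (T + 4) \<tau>"
  proof (rule runs_If[where T="2 + T"])
    assume "eval_expr (Var 26) ?\<sigma> \<noteq> Atom"
    then show "runs (Seq (Assign 26 NilE) c) ?\<sigma> (2 + T) \<tau>"
      using assms(9) reset by (intro runs_Seq[where T=2 and U=T, OF runs_Assign]) auto
  next
    assume "eval_expr (Var 26) ?\<sigma> = Atom"
    then show "runs (Assign 26 NilE) ?\<sigma> (2 + T) \<tau>"
      using assms(10) reset by (intro runs_Assign) auto
  qed simp
  show ?thesis unfolding accept_prog_def by (rule runs_Seq[OF 1 2]) simp
qed

lemma runs_left_prog:
  assumes "\<mu> \<in> bitstrings w"
    and "\<sigma> 1 = par" "\<sigma> 5 = enc_list (map enc_bits (bit_lists r))"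
    and "\<sigma> 7 = enc_list (map (\<lambda>ms. enc_list (map enc_bits ms)) tuples)" "\<sigma> 20 = enc_bits \<mu>"
    and "\<And>i. i \<in> {22..37} \<union> {40..} \<Longrightarrow> \<sigma> i = Atom"
    and "\<tau> = \<sigma>(37 := enc_list (map enc_list (left_lists \<mu>)))"
  shows "runs (left_prog referee) \<sigma> (2 ^ r * (length tuples * (call_time + 32) + 20) + 6) \<tau>"
  unfolding left_prog_def
proof (rule runs_collect_map[where xs="bit_lists r" and en=enc_bits and acc=37 and ea=enc_list and
      ds="[]" and T="\<lambda>_. length tuples * (call_time + 32) + 12" and h="\<lambda>\<gamma>. [left_list \<mu> \<gamma>]"])
  fix \<gamma> ds c
  assume "\<gamma> \<in> set (bit_lists r)"
  then have \<gamma>: "\<gamma> \<in> bitstrings r" by (simp add: set_bit_lists)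
  let ?\<sigma> = "\<sigma>(37 := enc_list (map enc_list ds), 23 := c, 22 := enc_bits \<gamma>)"
  have 1: "runs (foreach 24 25 (Var 7) (accept_prog referee
      (Assign 36 (ConsE (ConsE (Var 22) (Var 24)) (Var 36))))) ?\<sigma>
      (length tuples * (call_time + 32) + 6) (?\<sigma>(36 := enc_list (left_list \<mu> \<gamma>)))"
  proof (rule runs_collect[where xs="tuples" and en="\<lambda>ms. enc_list (map enc_bits ms)" and acc=36 and
      ds="[]" and T="\<lambda>_. call_time + 6 + 18" and h="\<lambda>ms. if acc \<mu> \<gamma> ms then [left_node \<gamma> ms] else []"])
    fix ms ds' c'
    assume "ms \<in> set tuples"
    then show "runs (accept_prog referee (Assign 36 (ConsE (ConsE (Var 22) (Var 24)) (Var 36))))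
        (?\<sigma>(36 := enc_list ds', 25 := c', 24 := enc_list (map enc_bits ms))) (call_time + 6 + 18)
        (?\<sigma>(36 := enc_list ((if acc \<mu> \<gamma> ms then [left_node \<gamma> ms] else []) @ ds'), 25 := c',
          24 := enc_list (map enc_bits ms)))"
      by (rule runs_accept_prog[OF assms(1) \<gamma>])
        (use assms in \<open>auto intro!: runs_Assign simp: fun_eq_iff left_node_def\<close>)
  next
    show "(\<Sum>ms\<leftarrow>tuples. call_time + 6 + 18 + 8) + 5 + expr_cost (Var 7) \<le> length tuples * (call_time + 32) + 6"
      unfolding sum_list_triv by simp
  qed (use assms in \<open>auto simp: fun_eq_iff left_list_def\<close>)
  show "runs (Seq (foreach 24 25 (Var 7) (accept_prog referee
         (Assign 36 (ConsE (ConsE (Var 22) (Var 24)) (Var 36)))))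
       (Seq (Assign 37 (ConsE (Var 36) (Var 37))) (Assign 36 NilE))) ?\<sigma>
       (length tuples * (call_time + 32) + 12)
       (\<sigma>(37 := enc_list (map enc_list ([left_list \<mu> \<gamma>] @ ds)), 23 := c, 22 := enc_bits \<gamma>))"
    by (rule runs_Seq[OF 1 runs_Seq[OF runs_Assign_exact runs_Assign_eq order_refl]])
      (use assms in \<open>auto simp: fun_eq_iff\<close>)
next
  show "\<tau> = \<sigma>(37 := enc_list (map enc_list (concat (rev (map (\<lambda>\<gamma>. [left_list \<mu> \<gamma>])
      (bit_lists r))) @ [])))"
    unfolding assms(7) concat_rev_singletons left_lists_def by simp
  show "(\<Sum>\<gamma>\<leftarrow>bit_lists r. length tuples * (call_time + 32) + 12 + 8) + 5 + expr_cost (Var 5)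
      \<le> 2 ^ r * (length tuples * (call_time + 32) + 20) + 6"
    unfolding sum_list_triv length_bit_lists by (simp add: ac_simps)
qed (use assms in auto)

lemma runs_edge_prog:
  assumes "\<mu> \<in> bitstrings w"
    and "\<sigma> 1 = par" "\<sigma> 5 = enc_list (map enc_bits (bit_lists r))"
    and "\<sigma> 7 = enc_list (map (\<lambda>ms. enc_list (map enc_bits ms)) tuples)"
    and "\<sigma> 8 = enc_list (map (enc_numbered enc_set) (numbered As))" "\<sigma> 20 = enc_bits \<mu>"
    and "\<And>i. i \<in> {22..36} \<union> {38} \<union> {40..} \<Longrightarrow> \<sigma> i = Atom"
    and "\<tau> = \<sigma>(38 := enc_list (map enc_edge (edge_list \<mu>)))"
  shows "runs (edge_prog player referee) \<sigma>
    ((\<Sum>\<gamma>\<leftarrow>bit_lists r. (\<Sum>ms\<leftarrow>tuples. call_time + tuple_time \<gamma> ms + 26) + 14) + 6) \<tau>"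
  unfolding edge_prog_def
proof (rule runs_collect_map[where xs="bit_lists r" and en=enc_bits and acc=38 and ea=enc_edge and
      ds="[]" and T="\<lambda>\<gamma>. (\<Sum>ms\<leftarrow>tuples. call_time + tuple_time \<gamma> ms + 26) + 6" and
      h="\<lambda>\<gamma>. concat (rev (map (\<lambda>ms. if acc \<mu> \<gamma> ms then tuple_edges \<gamma> ms else []) tuples))"])
  fix \<gamma> ds c
  assume "\<gamma> \<in> set (bit_lists r)"
  then have \<gamma>: "\<gamma> \<in> bitstrings r" by (simp add: set_bit_lists)
  let ?\<sigma> = "\<lambda>ds. \<sigma>(38 := enc_list (map enc_edge ds), 23 := c, 22 := enc_bits \<gamma>)"
  let ?h = "\<lambda>ms. if acc \<mu> \<gamma> ms then tuple_edges \<gamma> ms else []"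
  show "runs (foreach 24 25 (Var 7) (accept_prog referee (tuple_prog player))) (?\<sigma> ds)
      ((\<Sum>ms\<leftarrow>tuples. call_time + tuple_time \<gamma> ms + 26) + 6)
      (?\<sigma> (concat (rev (map ?h tuples)) @ ds))"
  proof (rule runs_collect_map[where xs="tuples" and en="\<lambda>ms. enc_list (map enc_bits ms)" and acc=38
      and ea=enc_edge and ds=ds and T="\<lambda>ms. call_time + tuple_time \<gamma> ms + 18" and h="?h"])
    fix ms ds' c'
    assume ms: "ms \<in> set tuples"
    show "runs (accept_prog referee (tuple_prog player))
        ((?\<sigma> ds)(38 := enc_list (map enc_edge ds'), 25 := c', 24 := enc_list (map enc_bits ms)))
        (call_time + tuple_time \<gamma> ms + 18)
        ((?\<sigma> ds)(38 := enc_list (map enc_edge (?h ms @ ds')), 25 := c',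
          24 := enc_list (map enc_bits ms)))"
    proof (rule runs_accept_prog[OF assms(1) \<gamma> ms])
      assume "acc \<mu> \<gamma> ms"
      then show "runs (tuple_prog player)
        ((?\<sigma> ds)(38 := enc_list (map enc_edge ds'), 25 := c', 24 := enc_list (map enc_bits ms)))
        (tuple_time \<gamma> ms)
        ((?\<sigma> ds)(38 := enc_list (map enc_edge (?h ms @ ds')), 25 := c',
          24 := enc_list (map enc_bits ms)))"
        by (intro runs_tuple_prog[OF \<gamma> ms]) (use assms in \<open>auto simp: fun_eq_iff\<close>)
    qed (use assms in \<open>auto simp: fun_eq_iff\<close>)
  next
    show "(\<Sum>ms\<leftarrow>tuples. call_time + tuple_time \<gamma> ms + 18 + 8) + 5 + expr_cost (Var 7)
        \<le> (\<Sum>ms\<leftarrow>tuples. call_time + tuple_time \<gamma> ms + 26) + 6"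
      by (simp add: ac_simps)
  qed (use assms in \<open>auto simp: fun_eq_iff\<close>)
next
  show "(\<Sum>\<gamma>\<leftarrow>bit_lists r. (\<Sum>ms\<leftarrow>tuples. call_time + tuple_time \<gamma> ms + 26) + 6 + 8) + 5 + expr_cost (Var 5)
      \<le> (\<Sum>\<gamma>\<leftarrow>bit_lists r. (\<Sum>ms\<leftarrow>tuples. call_time + tuple_time \<gamma> ms + 26) + 14) + 6"
    by (simp add: ac_simps)
qed (use assms in \<open>auto simp: edge_list_def\<close>)

end

section \<open>Running time\<close>

lemma sum_list_concat_map:
  "(\<Sum>x\<leftarrow>concat (map f xs). g x) = (\<Sum>x\<leftarrow>xs. \<Sum>y\<leftarrow>f x. (g y :: nat))"
  by (induction xs) auto

lemma sum_list_n_lists_Suc: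
  "(\<Sum>ms\<leftarrow>List.n_lists (Suc n) Y. g ms) =
    (\<Sum>ms\<leftarrow>List.n_lists n Y. \<Sum>y\<leftarrow>Y. (g (y # ms) :: nat))"
  by (simp add: sum_list_concat_map comp_def)

text \<open>Only half of the strings that agree with \<open>z\<close> so far agree in the next bit as well, so the
  comparison of \<open>z\<close> with a random string takes a constant number of steps on average.\<close>

lemma sum_common_prefix: "length z = l \<Longrightarrow> (\<Sum>y\<leftarrow>bit_lists l. common_prefix z y) \<le> 2 ^ l"
proof (induction z arbitrary: l)
  case (Cons b z)
  then obtain n where n: "l = Suc n" "length z = n" by auto
  have "(\<Sum>y\<leftarrow>bit_lists l. common_prefix (b # z) y) =
      (\<Sum>y\<leftarrow>bit_lists n. common_prefix z y + 1)"
    unfolding n sum_list_n_lists_Suc by (cases b) (auto simp: add.commute)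
  also have "\<dots> = (\<Sum>y\<leftarrow>bit_lists n. common_prefix z y) + 2 ^ n"
    by (simp add: sum_list_addf sum_list_triv length_bit_lists del: One_nat_def)
  finally show ?case using Cons.IH[OF n(2)] n by simp
qed simp

text \<open>Linearity of expectation for a uniformly random tuple: every component is uniform on
  \<open>Y\<close>, so the average costs \<open>G p\<close> of the positions add up. The induction
  splits off one position, each value of which occurs with every tail.\<close>

lemma sum_n_lists_zip_le:
  fixes g :: "'a \<Rightarrow> 'b \<Rightarrow> nat"
  assumes "\<And>p. p \<in> set ps \<Longrightarrow> (\<Sum>y\<leftarrow>Y. g p y) \<le> length Y * G p"
  shows "(\<Sum>ms\<leftarrow>List.n_lists (length ps) Y. \<Sum>(p, y)\<leftarrow>zip ps ms. g p y)
    \<le> length Y ^ length ps * (\<Sum>p\<leftarrow>ps. G p)"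
  using assms
proof (induction ps)
  case (Cons p ps)
  let ?n = "length ps"
  let ?R = "\<lambda>ms. \<Sum>(p, y)\<leftarrow>zip ps ms. g p y"
  have "(\<Sum>ms\<leftarrow>List.n_lists (length (p # ps)) Y. \<Sum>(p, y)\<leftarrow>zip (p # ps) ms. g p y) =
      (\<Sum>ms\<leftarrow>List.n_lists ?n Y. (\<Sum>y\<leftarrow>Y. g p y) + length Y * ?R ms)"
    unfolding list.size add_0_right add_Suc_right sum_list_n_lists_Suc
    by (simp add: sum_list_addf sum_list_triv)
  also have "\<dots> = length Y ^ ?n * (\<Sum>y\<leftarrow>Y. g p y) + length Y * (\<Sum>ms\<leftarrow>List.n_lists ?n Y. ?R ms)"
    by (simp add: sum_list_addf sum_list_triv length_n_lists sum_list_const_mult)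
  also have "\<dots> \<le> length Y ^ ?n * (length Y * G p) + length Y * (length Y ^ ?n * (\<Sum>p\<leftarrow>ps. G p))"
    using Cons by (intro add_mono mult_left_mono) auto
  also have "\<dots> = length Y ^ length (p # ps) * (\<Sum>p\<leftarrow>p # ps. G p)"
    by (simp add: algebra_simps)
  finally show ?case .
qed simp

lemma sum_powers_of_two_le: "(\<Sum>i<n. 2 ^ Suc i) \<le> 2 * (2 :: nat) ^ n"
  by (induction n) auto

section \<open>The complete reduction program\<close>

definition component_expr :: "nat \<Rightarrow> expr" where
  "component_expr i = Hd ((Tl ^^ i) (Var 1))"

text \<open>If \<open>k = 0\<close>, register 2 is \<open>Atom\<close> and a single empty message
  replaces the list of all \<open>2 ^ l\<close> messages, for which the budget
  \<open>2 ^ (w + r + l * k)\<close> has no room. Register 0 is cleared early because the final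
  reversal accumulates the output there.\<close>

definition reduction_prog :: "prog \<Rightarrow> prog \<Rightarrow> prog" where
  "reduction_prog player referee =
    Seq (Assign 1 (Hd (Var 0)))
   (Seq (Assign 2 (Hd (Tl (Var 0))))
   (Seq (Assign 0 NilE)
   (Seq (Assign 3 (ConsE NilE (ConsE (ConsE NilE NilE) NilE)))
   (Seq (tuples_prog (component_expr 3) 3 4)
   (Seq (tuples_prog (component_expr 4) 3 5)
   (Seq (If (Var 2) (tuples_prog (component_expr 5) 3 6) (Assign 6 (ConsE NilE NilE)))
   (Seq (tuples_prog (Var 2) 6 7)
   (Seq (number_prog 2 8)
   (Seq (right_prog 8 9)
   (Seq (instances_prog player referee)
        (reverse_prog 10 11 39 0)))))))))))"

lemma n_lists_map: "List.n_lists n (map g xs) = map (map g) (List.n_lists n xs)"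
  by (induction n) (auto simp: map_concat comp_def)

lemma enc_bit_lists:
  "map enc_list (List.n_lists n [Atom, Pair Atom Atom]) = map enc_bits (bit_lists n)"
  using n_lists_map[of n enc_bool "[False, True]"] by (simp add: enc_bits_def)

context smp_reduction
begin

lemma length_tuples: "length tuples = 2 ^ (l * length As)"
  by (simp add: tuples_def length_n_lists length_bit_lists power_mult numeral_2_eq_2)

text \<open>For fixed coins and a fixed input the message is fixed, while the component compared
  with it ranges over all strings; exchanging the sums brings this average inside. It is at most 14
  steps, which together with the 53 of \<open>element_time\<close> and the loop overhead of 8 makes
  75 per element.\<close>

lemma sum_tuple_time:
  assumes "\<gamma> \<in> bitstrings r"
  shows "(\<Sum>ms\<leftarrow>tuples. tuple_time \<gamma> ms) \<le> length tuples * ((call_time + 75) * psp_size As)"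
proof -
  let ?G = "\<lambda>A :: bits list. length A * (call_time + 75) + 18"
  have avg: "(\<Sum>y\<leftarrow>bit_lists l. set_time \<gamma> p y + 8) \<le> length (bit_lists l) * ?G (snd p)"
    if "p \<in> set (numbered As)" for p
  proof -
    have "(\<Sum>y\<leftarrow>bit_lists l. set_time \<gamma> p y + 8) =
        (\<Sum>y\<leftarrow>bit_lists l. \<Sum>x\<leftarrow>snd p. element_time \<gamma> (fst p) y x + 8) + 2 ^ l * 18"
      by (simp add: set_time_def sum_list_addf sum_list_triv length_bit_lists)
    also have "(\<Sum>y\<leftarrow>bit_lists l. \<Sum>x\<leftarrow>snd p. element_time \<gamma> (fst p) y x + 8) =
        (\<Sum>x\<leftarrow>snd p. \<Sum>y\<leftarrow>bit_lists l. element_time \<gamma> (fst p) y x + 8)"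
    proof -
      have "(\<Sum>y\<leftarrow>ys. \<Sum>x\<leftarrow>xs. g y x) = (\<Sum>x\<leftarrow>xs. \<Sum>y\<leftarrow>ys. g y x)"
        for g :: "bits \<Rightarrow> bits \<Rightarrow> nat" and xs ys
        by (induction ys) (simp_all add: sum_list_addf)
      then show ?thesis .
    qed
    also have "\<dots> \<le> (\<Sum>x\<leftarrow>snd p. 2 ^ l * (call_time + 75))"
    proof (rule sum_list_mono)
      fix x assume "x \<in> set (snd p)"
      then have "fst p < length As" "x \<in> bitstrings m"
        using numbered_mem_iff[THEN iffD1, OF that] sets by force+
      then have z: "length (msg (fst p) x \<gamma>) = l"
        using msg assms by (simp add: bitstrings_def)
      have "(\<Sum>y\<leftarrow>bit_lists l. element_time \<gamma> (fst p) y x + 8) =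
          14 * (\<Sum>y\<leftarrow>bit_lists l. common_prefix (msg (fst p) x \<gamma>) y) + 2 ^ l * (call_time + 61)"
        by (simp add: element_time_def sum_list_addf sum_list_triv length_bit_lists
            sum_list_const_mult algebra_simps)
      then show "(\<Sum>y\<leftarrow>bit_lists l. element_time \<gamma> (fst p) y x + 8) \<le> 2 ^ l * (call_time + 75)"
        using sum_common_prefix[OF z] by (simp add: algebra_simps)
    qed
    finally show ?thesis by (simp add: sum_list_triv length_bit_lists algebra_simps)
  qed
  have G: "(\<Sum>A\<leftarrow>As. ?G A) = sum_list (map length As) * (call_time + 75) + 18 * length As"
    by (simp add: sum_list_addf sum_list_triv sum_list_mult_const)
  have "(\<Sum>ms\<leftarrow>tuples. tuple_time \<gamma> ms) =
      (\<Sum>ms\<leftarrow>tuples. \<Sum>(p, y)\<leftarrow>zip (numbered As) ms. set_time \<gamma> p y + 8) + length tuples * 8"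
    by (simp add: tuple_time_def sum_list_addf sum_list_triv)
  also have "\<dots> \<le> length tuples * (\<Sum>p\<leftarrow>numbered As. ?G (snd p)) + length tuples * 8"
    using sum_n_lists_zip_le[where ps="numbered As" and Y="bit_lists l" and
        g="\<lambda>p y. set_time \<gamma> p y + 8" and G="\<lambda>p. ?G (snd p)", OF avg]
    unfolding tuples_def length_n_lists[of _ "bit_lists l"] length_numbered by linarith
  also have "\<dots> = length tuples * ((\<Sum>A\<leftarrow>As. ?G A) + 8)"
    unfolding sum_list_numbered[of ?G As, symmetric] by (simp add: algebra_simps)
  \<comment> \<open>The 18 steps per set and the 8 per tuple are absorbed because
    \<open>psp_size\<close> counts the sets as well and adds 1.\<close>
  also have "\<dots> \<le> length tuples * ((call_time + 75) * psp_size As)"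
    unfolding G by (intro mult_left_mono) (simp_all add: psp_size_def algebra_simps)
  finally show ?thesis .
qed

text \<open>The three calls are the referee for the left nodes, the referee for the edges, and the
  player, the last one for each element. The 210 consists of 52 for the left nodes, 115 for the
  edges and 43 for additive constants.\<close>

definition instance_time :: nat where
  "instance_time = 2 ^ r * length tuples * psp_size As * (3 * call_time + 210)"

lemma runs_instances_prog:
  assumes "\<sigma> 1 = par" "\<sigma> 4 = enc_list (map enc_bits (bit_lists w))"
    and "\<sigma> 5 = enc_list (map enc_bits (bit_lists r))"
    and "\<sigma> 7 = enc_list (map (\<lambda>ms. enc_list (map enc_bits ms)) tuples)"
    and "\<sigma> 8 = enc_list (map (enc_numbered enc_set) (numbered As))"
    and "\<sigma> 9 = enc_list (map enc_list (right_lists As))"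
    and "\<And>i. i \<ge> 20 \<Longrightarrow> \<sigma> i = Atom"
    and "\<tau> = \<sigma>(39 := enc_list (rev (map instance_data (bit_lists w))))"
  shows "runs (instances_prog player referee) \<sigma> (2 ^ w * instance_time + 6) \<tau>"
  unfolding instances_prog_def
proof (rule runs_collect[where xs="bit_lists w" and en=enc_bits and acc=39 and
      ds="[]" and T="\<lambda>_. instance_time - 8" and h="\<lambda>\<mu>. [instance_data \<mu>]"])
  fix \<mu> ds c
  assume "\<mu> \<in> set (bit_lists w)"
  then have \<mu>: "\<mu> \<in> bitstrings w" by (simp add: set_bit_lists)
  let ?\<sigma> = "\<sigma>(39 := enc_list ds, 21 := c, 20 := enc_bits \<mu>)"
  let ?LT = "2 ^ r * (length tuples * (call_time + 32) + 20) + 6"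
  let ?ET = "(\<Sum>\<gamma>\<leftarrow>bit_lists r. (\<Sum>ms\<leftarrow>tuples. call_time + tuple_time \<gamma> ms + 26) + 14) + 6"
  have time: "?LT + (?ET + 14) \<le> instance_time - 8"
  proof -
    let ?Z = "psp_size As"
    have Z: "1 \<le> ?Z" by (simp add: psp_size_def)
    have T: "1 \<le> length tuples" by (simp add: length_tuples)
    have "?ET \<le> (\<Sum>\<gamma>\<leftarrow>bit_lists r. length tuples * (?Z * (2 * call_time + 115))) + 6"
    proof (intro add_mono sum_list_mono order_refl)
      fix \<gamma> assume "\<gamma> \<in> set (bit_lists r)"
      then have "(\<Sum>ms\<leftarrow>tuples. tuple_time \<gamma> ms) \<le> length tuples * ((call_time + 75) * ?Z)"
        by (intro sum_tuple_time) (simp add: set_bit_lists)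
      then have "(\<Sum>ms\<leftarrow>tuples. call_time + tuple_time \<gamma> ms + 26) + 14
          \<le> length tuples * ((call_time + 75) * ?Z) + length tuples * (call_time + 26) + 14"
        by (simp add: sum_list_addf sum_list_triv algebra_simps)
      also have "\<dots> \<le> length tuples * ((call_time + 75) * ?Z) + length tuples * (call_time + 26) + length tuples * 14"
        using T by simp
      also have "\<dots> = length tuples * ((call_time + 75) * ?Z + (call_time + 40) * 1)"
        by (simp add: algebra_simps)
      also have "\<dots> \<le> length tuples * ((call_time + 75) * ?Z + (call_time + 40) * ?Z)"
        using Z by (intro mult_left_mono add_left_mono) auto
      also have "\<dots> = length tuples * (?Z * (2 * call_time + 115))"
        by (simp add: algebra_simps)
      finally show "(\<Sum>ms\<leftarrow>tuples. call_time + tuple_time \<gamma> ms + 26) + 14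
          \<le> length tuples * (?Z * (2 * call_time + 115))" .
    qed
    also have "\<dots> = 2 ^ r * length tuples * ?Z * (2 * call_time + 115) + 6"
      by (simp add: sum_list_triv length_bit_lists algebra_simps)
    finally have ET: "?ET \<le> 2 ^ r * length tuples * ?Z * (2 * call_time + 115) + 6" .
    define D where "D = 2 ^ r * length tuples * ?Z"
    have rT: "2 ^ r * length tuples \<le> D" "1 \<le> D" "2 ^ r \<le> D"
      unfolding D_def using Z T by simp_all
    have "?LT = (2 ^ r * length tuples) * (call_time + 32) + 2 ^ r * 20 + 6" by (simp add: algebra_simps)
    also have "\<dots> \<le> D * (call_time + 32) + D * 20 + 6"
      using rT by (intro add_mono mult_right_mono) auto
    finally have LT: "?LT \<le> D * (call_time + 52) + 6" by (simp add: algebra_simps)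
    have "D * (3 * call_time + 210) = D * (call_time + 52) + D * (2 * call_time + 115) + 43 * D"
      by (simp add: algebra_simps)
    then show ?thesis using ET LT rT(2) unfolding instance_time_def D_def[symmetric] by linarith
  qed
  have 1: "runs (left_prog referee) ?\<sigma> ?LT (?\<sigma>(37 := enc_list (map enc_list (left_lists \<mu>))))"
    by (rule runs_left_prog[OF \<mu>]) (use assms in auto)
  have 2: "runs (edge_prog player referee) (?\<sigma>(37 := enc_list (map enc_list (left_lists \<mu>)))) ?ET
      (?\<sigma>(37 := enc_list (map enc_list (left_lists \<mu>)), 38 := enc_list (map enc_edge (edge_list \<mu>))))"
    by (rule runs_edge_prog[OF \<mu>]) (use assms in auto)
  have 3: "runs (Seq (Assign 39 (ConsE (ConsE (Var 37) (ConsE (Var 9) (ConsE (Var 38) NilE))) (Var 39)))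
        (Seq (Assign 37 NilE) (Assign 38 NilE)))
      (?\<sigma>(37 := enc_list (map enc_list (left_lists \<mu>)), 38 := enc_list (map enc_edge (edge_list \<mu>))))
      14 (\<sigma>(39 := enc_list ([instance_data \<mu>] @ ds), 21 := c, 20 := enc_bits \<mu>))"
    by (rule runs_Seq[OF runs_Assign_exact runs_Seq[OF runs_Assign_exact runs_Assign_eq order_refl]])
      (use assms in \<open>auto simp: fun_eq_iff instance_data_def\<close>)
  show "runs (Seq (left_prog referee) (Seq (edge_prog player referee)
       (Seq (Assign 39 (ConsE (ConsE (Var 37) (ConsE (Var 9) (ConsE (Var 38) NilE))) (Var 39)))
         (Seq (Assign 37 NilE) (Assign 38 NilE))))) ?\<sigma> (instance_time - 8)
      (\<sigma>(39 := enc_list ([instance_data \<mu>] @ ds), 21 := c, 20 := enc_bits \<mu>))"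
    by (rule runs_Seq[OF 1 runs_Seq[OF 2 3 order_refl] time])
next
  \<comment> \<open>Each round was budgeted with \<open>instance_time - 8\<close> to leave room for
    the loop overhead; this bound excludes truncation when the 8 is added back.\<close>
  have "1 * 1 * 1 * 8 \<le> instance_time"
    unfolding instance_time_def by (intro mult_le_mono) (simp_all add: length_tuples psp_size_def)
  then show "(\<Sum>\<mu>\<leftarrow>bit_lists w. instance_time - 8 + 8) + 5 + expr_cost (Var 4)
      \<le> 2 ^ w * instance_time + 6"
    unfolding sum_list_triv length_bit_lists by simp
qed (use assms in \<open>auto simp: concat_rev_singletons\<close>)

end

lemma eval_component_expr:
  "\<sigma> 1 = enc_list [d0, d1, d2, d3, d4, d5] \<Longrightarrow> i < 6 \<Longrightarrow>
    eval_expr (component_expr i) \<sigma> = [d0, d1, d2, d3, d4, d5] ! i"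
proof -
  have "eval_expr ((Tl ^^ i) e) \<sigma> = (dsnd ^^ i) (eval_expr e \<sigma>)" for e by (induction i) auto
  moreover assume "\<sigma> 1 = enc_list [d0, d1, d2, d3, d4, d5]" "i < 6"
  ultimately show ?thesis
    unfolding component_expr_def by (auto simp: numeral_eq_Suc less_Suc_eq)
qed

lemma cost_component_expr [simp]: "expr_cost (component_expr i) = i + 2"
proof -
  have "expr_cost ((Tl ^^ i) e) = expr_cost e + i" for e by (induction i) auto
  then show ?thesis by (simp add: component_expr_def)
qed

context smp_reduction
begin

lemma computes_reduction_prog:
  assumes par: "par = enc_list [d0, d1, d2, enc_unary w, enc_unary r, enc_unary l]"
  shows "computes_within (reduction_prog player referee) (enc_list [par, enc_psp As])
    (enc_list (map instance_data (bit_lists w)))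
    (2 ^ (w + r + l * length As) * (3 * call_time + 1000) * psp_size As)"
proof -
  let ?k = "length As"
  let ?Z = "psp_size As"
  let ?M = "2 ^ (w + r + l * ?k) :: nat"
  define L where "L = (if As = [] then [[]] else bit_lists l)"
  define \<sigma>1 :: store where "\<sigma>1 = (\<lambda>_. Atom)(1 := par, 2 := enc_psp As)"
  define \<sigma>3 where "\<sigma>3 = \<sigma>1(3 := enc_list [Atom, Pair Atom Atom])"
  define \<sigma>4 where "\<sigma>4 = \<sigma>3(4 := enc_list (map enc_bits (bit_lists w)))"
  define \<sigma>5 where "\<sigma>5 = \<sigma>4(5 := enc_list (map enc_bits (bit_lists r)))"
  define \<sigma>6 where "\<sigma>6 = \<sigma>5(6 := enc_list (map enc_bits L))"
  define \<sigma>7 where "\<sigma>7 = \<sigma>6(7 := enc_list (map (\<lambda>ms. enc_list (map enc_bits ms)) tuples))"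
  define \<sigma>8 where "\<sigma>8 = \<sigma>7(8 := enc_list (map (enc_numbered enc_set) (numbered As)))"
  define \<sigma>9 where "\<sigma>9 = \<sigma>8(9 := enc_list (map enc_list (right_lists As)))"
  define \<sigma>10 where "\<sigma>10 = \<sigma>9(39 := enc_list (rev (map instance_data (bit_lists w))))"
  note defs = \<sigma>1_def \<sigma>3_def \<sigma>4_def \<sigma>5_def \<sigma>6_def \<sigma>7_def \<sigma>8_def \<sigma>9_def \<sigma>10_def
  let ?\<sigma> = "(\<lambda>_. Atom)(0 := enc_list [par, enc_psp As])"
  have unary: "enc_unary n = enc_list (replicate n Atom)" for n by (simp add: enc_unary_def)
  have comp: "eval_expr (component_expr i) \<tau> = [d0, d1, d2, enc_unary w, enc_unary r, enc_unary l] ! i"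
    if "\<tau> 1 = par" "i < 6" for \<tau> i
    by (rule eval_component_expr) (use that par in simp_all)
  have T3: "runs (tuples_prog (component_expr 3) 3 4) \<sigma>3 (128 * 2 ^ w + 14) \<sigma>4"
    by (rule runs_tuples_prog[where us="replicate w Atom" and L="[Atom, Pair Atom Atom]"])
      (use sum_powers_of_two_le[of w] in \<open>auto simp: defs comp unary enc_bit_lists numeral_2_eq_2[symmetric]
        simp del: power_Suc\<close>)
  have T4: "runs (tuples_prog (component_expr 4) 3 5) \<sigma>4 (128 * 2 ^ r + 15) \<sigma>5"
    by (rule runs_tuples_prog[where us="replicate r Atom" and L="[Atom, Pair Atom Atom]"])
      (use sum_powers_of_two_le[of r] in \<open>auto simp: defs comp unary enc_bit_lists numeral_2_eq_2[symmetric]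
        simp del: power_Suc\<close>)
  have T5: "runs (If (Var 2) (tuples_prog (component_expr 5) 3 6) (Assign 6 (ConsE NilE NilE))) \<sigma>5
      (128 * 2 ^ (l * ?k) + 18) \<sigma>6"
  proof (rule runs_If[where T="128 * 2 ^ (l * ?k) + 16"])
    assume "eval_expr (Var 2) \<sigma>5 \<noteq> Atom"
    then have "As \<noteq> []" by (auto simp: defs enc_psp_def)
    \<comment> \<open>The point where an empty product has to be excluded: for \<open>k = 0\<close>
      this fails as soon as \<open>l\<close> is positive.\<close>
    then have "l \<le> l * ?k" by (cases As) auto
    then have "(2 :: nat) ^ l \<le> 2 ^ (l * ?k)" by (rule power_increasing) simp
    with sum_powers_of_two_le[of l] have sum: "(\<Sum>i<l. 2 ^ Suc i) \<le> 2 * (2 :: nat) ^ (l * ?k)"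
      by linarith
    show "runs (tuples_prog (component_expr 5) 3 6) \<sigma>5 (128 * 2 ^ (l * ?k) + 16) \<sigma>6"
      by (intro runs_tuples_prog[where us="replicate l Atom" and L="[Atom, Pair Atom Atom]"])
        (use sum \<open>As \<noteq> []\<close> in \<open>auto simp: defs comp unary enc_bit_lists L_def
          numeral_2_eq_2[symmetric] simp del: power_Suc\<close>)
  next
    assume "eval_expr (Var 2) \<sigma>5 = Atom"
    then have "As = []" by (auto simp: defs enc_psp_def)
    then show "runs (Assign 6 (ConsE NilE NilE)) \<sigma>5 (128 * 2 ^ (l * ?k) + 16) \<sigma>6"
      by (intro runs_Assign) (auto simp: defs L_def)
  qed simp
  \<comment> \<open>If \<open>As\<close> is empty, both sides list only the empty tuple, so the
    substitute alphabet does no harm.\<close>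
  have tuples: "map (\<lambda>ms. enc_list (map enc_bits ms)) tuples =
      map enc_list (List.n_lists ?k (map enc_bits L))"
    unfolding tuples_def L_def by (simp add: n_lists_map)
  have L: "L \<noteq> []"
    using length_bit_lists[of l] unfolding L_def by (metis length_0_conv list.simps(3) power_not_zero zero_neq_numeral)
  have T7: "runs (tuples_prog (Var 2) 6 7) \<sigma>6 (64 * ?k * 2 ^ (l * ?k) + 10) \<sigma>7"
  proof (rule runs_tuples_prog[where us="map (\<lambda>A. enc_list (map enc_bits A)) As" and L="map enc_bits L"])
    \<comment> \<open>Bounding every stage by the last one, instead of summing a geometric series,
      covers \<open>l = 0\<close> too. The extra factor \<open>k\<close> is paid for by
      \<open>psp_size\<close>.\<close>
    have "(\<Sum>i<?k. length L ^ Suc i) \<le> (\<Sum>i<?k. 2 ^ (l * ?k))"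
    proof (rule sum_mono)
      fix i assume "i \<in> {..<?k}"
      then have "length L ^ Suc i \<le> length L ^ ?k"
        using L by (intro power_increasing) (auto simp: Suc_le_eq)
      also have "\<dots> = 2 ^ (l * ?k)" by (simp add: L_def length_bit_lists power_mult)
      finally show "length L ^ Suc i \<le> 2 ^ (l * ?k)" .
    qed
    then show "64 * (\<Sum>i<length (map (\<lambda>A. enc_list (map enc_bits A)) As).
        length (map enc_bits L) ^ Suc i) + expr_cost (Var 2) + 9 \<le> 64 * ?k * 2 ^ (l * ?k) + 10"
      by simp
  qed (use L in \<open>auto simp: defs enc_psp_def tuples\<close>)
  have T8: "runs (number_prog 2 8) \<sigma>7 (66 * ?k + 20) \<sigma>8"
    by (rule runs_number_prog[where en=enc_set and xs=As]) (auto simp: defs enc_psp_def enc_set_def[abs_def])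
  have "(\<Sum>A\<leftarrow>As. 15 * length A + 21) = 15 * sum_list (map length As) + 21 * ?k"
    by (simp add: sum_list_addf sum_list_triv sum_list_const_mult)
  then have T9: "runs (right_prog 8 9) \<sigma>8 (21 * ?Z) \<sigma>9"
    by (intro runs_right_prog) (auto simp: defs psp_size_def)
  have T10: "runs (instances_prog player referee) \<sigma>9 (2 ^ w * instance_time + 6) \<sigma>10"
    by (rule runs_instances_prog) (auto simp: defs)
  have T11: "runs (reverse_prog 10 11 39 0) \<sigma>10 (12 * 2 ^ w + 6)
      (\<sigma>10(0 := enc_list (map instance_data (bit_lists w))))"
    using runs_reverse_prog[of 10 11 39 0 \<sigma>10 "rev (map instance_data (bit_lists w))"]
    by (simp add: defs length_bit_lists)
  have "runs (reduction_prog player referee) ?\<sigma> (?M * (3 * call_time + 1000) * ?Z)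
      (\<sigma>10(0 := enc_list (map instance_data (bit_lists w))))"
  proof -
    have A1: "runs (Assign 1 (Hd (Var 0))) ?\<sigma> 3 (?\<sigma>(1 := par))" by (rule runs_Assign) auto
    have A2: "runs (Assign 2 (Hd (Tl (Var 0)))) (?\<sigma>(1 := par)) 4 (?\<sigma>(1 := par, 2 := enc_psp As))"
      by (rule runs_Assign) auto
    have A3: "runs (Assign 0 NilE) (?\<sigma>(1 := par, 2 := enc_psp As)) 2 \<sigma>1"
      by (rule runs_Assign) (auto simp: defs fun_eq_iff)
    have A4: "runs (Assign 3 (ConsE NilE (ConsE (ConsE NilE NilE) NilE))) \<sigma>1 8 \<sigma>3"
      by (rule runs_Assign) (auto simp: defs)
    define D where "D = ?M * ?Z"
    have Z: "1 \<le> ?Z" "?k \<le> ?Z" by (simp_all add: psp_size_def)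
    have M: "2 ^ w \<le> ?M" "2 ^ r \<le> ?M" "2 ^ (l * ?k) \<le> ?M" "1 \<le> ?M"
      by (rule power_increasing; simp)+ simp
    have le: "x \<le> D" if "x \<le> ?M" for x
      using mult_le_mono[OF that Z(1)] by (simp add: D_def)
    have k: "?k * 2 ^ (l * ?k) \<le> D"
      using mult_le_mono[OF M(3) Z(2)] by (simp add: D_def mult.commute)
    have ZD: "?Z \<le> D" using mult_le_mono[OF M(4) order_refl[of ?Z]] by (simp add: D_def)
    have I: "2 ^ w * instance_time = D * (3 * call_time + 210)"
      unfolding instance_time_def length_tuples D_def by (simp add: power_add)
    \<comment> \<open>Coefficients and constants of all phases other than the instances add up to
      less than 790, the rest of 1000 after the 210 in \<open>instance_time\<close>.\<close>
    have "3 + (4 + (2 + (8 + ((128 * 2 ^ w + 14) + ((128 * 2 ^ r + 15) + ((128 * 2 ^ (l * ?k) + 18) +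
        ((64 * ?k * 2 ^ (l * ?k) + 10) + ((66 * ?k + 20) + (21 * ?Z + ((2 ^ w * instance_time + 6) +
        (12 * 2 ^ w + 6))))))))))) \<le> D * (3 * call_time + 210) + 790 * D"
      unfolding I using le[OF M(1)] le[OF M(2)] le[OF M(3)] le[OF M(4)] k ZD Z
      by (simp only: mult.assoc)
    also have "\<dots> = ?M * (3 * call_time + 1000) * ?Z" by (simp add: D_def algebra_simps)
    finally show ?thesis unfolding reduction_prog_def
      by (intro runs_mono[OF runs_Seq[OF A1 runs_Seq[OF A2 runs_Seq[OF A3 runs_Seq[OF A4
        runs_Seq[OF T3 runs_Seq[OF T4 runs_Seq[OF T5 runs_Seq[OF T7 runs_Seq[OF T8 runs_Seq[OF T9
        runs_Seq[OF T10 T11 order_refl] order_refl] order_refl] order_refl] order_refl] order_refl]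
        order_refl] order_refl] order_refl] order_refl] order_refl]])
  qed
  moreover have "(\<sigma>10(0 := out)) 0 = out" for out by simp
  ultimately show ?thesis unfolding computes_within_def runs_def by blast
qed

end

section \<open>The label cover graphs\<close>

lemma disjoint_family_on_nth_map:
  assumes "distinct xs" "\<And>x y. x \<in> set xs \<Longrightarrow> y \<in> set xs \<Longrightarrow> x \<noteq> y \<Longrightarrow> B x \<inter> B y = {}"
  shows "disjoint_family_on ((!) (map B xs)) {..<length (map B xs)}"
  using assms by (auto simp: disjoint_family_on_def nth_eq_iff_index_eq Int_commute)

lemma card_nth_filter:
  "distinct xs \<Longrightarrow> card {i. i < length xs \<and> P (xs ! i)} = card {x \<in> set xs. P x}"
  by (metis (no_types) distinct_card distinct_filter length_filter_conv_card set_filter)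

lemma right_node_eq_iff [simp]: "right_node i x = right_node j y \<longleftrightarrow> i = j \<and> x = y"
  by (simp add: right_node_def binary_eq_iff)

lemma left_node_eq_iff [simp]: "left_node \<gamma> ms = left_node \<gamma>' ms' \<longleftrightarrow> \<gamma> = \<gamma>' \<and> ms = ms'"
  by (simp add: left_node_def enc_list_eq_iff inj_map_eq_map inj_def)

lemma set_numbered: "set (numbered xs) = (\<lambda>j. (j, xs ! j)) ` {..<length xs}"
  by (auto simp: numbered_mem_iff)

lemma distinct_numbered: "distinct (numbered xs)"
  by (simp add: numbered_def distinct_zipI1)

lemma finite_bitstrings [simp]: "finite (bitstrings n)"
  unfolding set_bit_lists[symmetric] by simp

lemma distinct_bit_lists: "distinct (bit_lists n)"
  by (rule distinct_n_lists) simp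

lemma card_bitstrings: "card (bitstrings n) = 2 ^ n"
  using distinct_card[OF distinct_bit_lists, of n] by (simp add: set_bit_lists length_bit_lists)

lemma nth_numbered: "i < length xs \<Longrightarrow> numbered xs ! i = (i, xs ! i)"
  by (simp add: numbered_def)

lemma set_zip_numbered:
  "length ms = length xs \<Longrightarrow> set (zip (numbered xs) ms) = (\<lambda>j. ((j, xs ! j), ms ! j)) ` {..<length xs}"
  by (auto simp: set_zip nth_numbered; metis nth_numbered)

context smp_reduction
begin

definition instance_graph :: "bits \<Rightarrow> (data, data) label_cover" where
  "instance_graph \<mu> = \<lparr>left_super = map set (left_lists \<mu>),
     right_super = map set (right_lists As), edges = set (edge_list \<mu>)\<rparr>"

lemma lists_instance_graph: "lists_label_cover (instance_data \<mu>) (instance_graph \<mu>)"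
  unfolding lists_label_cover_def instance_data_def instance_graph_def enc_edge_def by auto

lemma set_left_list:
  "set (left_list \<mu> \<gamma>) = left_node \<gamma> ` {ms \<in> smp_inputs l (length As). acc \<mu> \<gamma> ms}"
  by (auto simp: left_list_def set_tuples[symmetric] split: if_splits)

lemma left_super_graph:
  "left_super (instance_graph \<mu>) = map (\<lambda>\<gamma>. set (left_list \<mu> \<gamma>)) (rev (bit_lists r))"
  by (simp add: instance_graph_def left_lists_def rev_map comp_def)

lemma right_super_graph:
  "right_super (instance_graph \<mu>) =
    map (\<lambda>p. right_node (fst p) ` set (snd p)) (rev (numbered As))"
  by (simp add: instance_graph_def right_lists_def rev_map comp_def)

lemma set_tuple_edges:
  assumes "ms \<in> smp_inputs l (length As)"
  shows "set (tuple_edges \<gamma> ms) = {(left_node \<gamma> ms, right_node j x) | j x.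
    j < length As \<and> x \<in> set (As ! j) \<and> msg j x \<gamma> = ms ! j}"
proof -
  have "length ms = length As" using assms by (simp add: smp_inputs_def)
  then show ?thesis
    unfolding tuple_edges_def set_concat set_rev set_map set_zip_numbered[OF \<open>length ms = length As\<close>]
    by (auto simp: set_edges_def element_edges_def split: if_splits)
qed

lemma edge_iff:
  "(u, v) \<in> edges (instance_graph \<mu>) \<longleftrightarrow> (\<exists>\<gamma> ms j x. \<gamma> \<in> bitstrings r \<and>
    ms \<in> smp_inputs l (length As) \<and> acc \<mu> \<gamma> ms \<and> j < length As \<and> x \<in> set (As ! j) \<and>
    msg j x \<gamma> = ms ! j \<and> u = left_node \<gamma> ms \<and> v = right_node j x)"
proof -
  have "set (edge_list \<mu>) = (\<Union>\<gamma>\<in>bitstrings r. \<Union>ms\<in>{ms \<in> smp_inputs l (length As). acc \<mu> \<gamma> ms}.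
      set (tuple_edges \<gamma> ms))"
    by (auto simp: edge_list_def set_bit_lists set_tuples split: if_splits)
  then show ?thesis
    unfolding instance_graph_def using set_tuple_edges by (auto; blast)
qed

lemma right_nodes_graph:
  "right_nodes (instance_graph \<mu>) = (\<Union>j<length As. right_node j ` set (As ! j))"
  by (simp add: right_nodes_def right_super_graph set_numbered image_image)

lemma left_nodes_graph:
  "left_nodes (instance_graph \<mu>) = (\<Union>\<gamma>\<in>bitstrings r. set (left_list \<mu> \<gamma>))"
  by (simp add: left_nodes_def left_super_graph set_bit_lists)

lemma label_cover_instance_graph: "label_cover_instance (instance_graph \<mu>)"
  unfolding label_cover_instance_def
proof (intro conjI)
  show "finite (left_nodes (instance_graph \<mu>))"
    by (simp add: left_nodes_graph)
  show "finite (right_nodes (instance_graph \<mu>))"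
    by (simp add: right_nodes_graph)
  show "disjoint_family_on ((!) (left_super (instance_graph \<mu>)))
      {..<length (left_super (instance_graph \<mu>))}"
    unfolding left_super_graph
    by (rule disjoint_family_on_nth_map) (auto simp: distinct_bit_lists set_left_list)
  show "disjoint_family_on ((!) (right_super (instance_graph \<mu>)))
      {..<length (right_super (instance_graph \<mu>))}"
    unfolding right_super_graph
    by (rule disjoint_family_on_nth_map) (auto simp: distinct_numbered numbered_mem_iff)
  show "edges (instance_graph \<mu>) \<subseteq> left_nodes (instance_graph \<mu>) \<times> right_nodes (instance_graph \<mu>)"
    by (auto simp: edge_iff left_nodes_graph right_nodes_graph set_left_list; blast)
qed

lemma card_right_nodes:
  assumes "\<And>A. A \<in> set As \<Longrightarrow> length A \<le> N"
  shows "card (right_nodes (instance_graph \<mu>)) \<le> N * length As"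
proof -
  have "card (right_nodes (instance_graph \<mu>)) \<le> (\<Sum>j<length As. card (right_node j ` set (As ! j)))"
    unfolding right_nodes_graph by (rule card_UN_le) simp
  also have "\<dots> \<le> (\<Sum>j<length As. N)"
    using assms by (intro sum_mono) (meson card_image_le card_length le_trans lessThan_iff
      nth_mem finite_set)
  finally show ?thesis by (simp add: mult.commute)
qed

lemma left_alphabet_size_graph: "left_alphabet_size (instance_graph \<mu>) \<le> 2 ^ (l * length As)"
proof -
  \<comment> \<open>\<open>Max\<close> needs a nonempty set; there is a coin string even for
    \<open>r = 0\<close>.\<close>
  have ne: "bit_lists r \<noteq> []" using length_bit_lists[of r] by (metis list.size(3) power_not_zero zero_neq_numeral)
  have "card (set (left_list \<mu> \<gamma>)) \<le> 2 ^ (l * length As)" for \<gamma>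
  proof -
    have "card (set (left_list \<mu> \<gamma>)) \<le> card (left_node \<gamma> ` set tuples)"
      unfolding set_left_list set_tuples[symmetric] by (intro card_mono) auto
    also have "\<dots> \<le> length tuples" by (meson card_image_le card_length finite_set le_trans)
    finally show ?thesis by (simp add: length_tuples)
  qed
  then show ?thesis
    unfolding left_alphabet_size_def left_super_graph using ne by (subst Max_le_iff) auto
qed

section \<open>Labelings as choices of inputs, and their acceptance probability\<close>

definition choice_labels :: "bits list \<Rightarrow> data set" where
  "choice_labels xs = (\<lambda>j. right_node j (xs ! j)) ` {..<length As}"

lemma choice_inputs:
  assumes "list_all2 (\<lambda>x A. x \<in> set A) xs As"
  shows "xs \<in> smp_inputs m (length As)"
proof -
  have "length xs = length As" "\<And>j. j < length As \<Longrightarrow> xs ! j \<in> set (As ! j)"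
    using assms by (auto simp: list_all2_conv_all_nth)
  moreover have "set (As ! j) \<subseteq> bitstrings m" if "j < length As" for j
    using sets that by simp
  ultimately have "length xs = length As" "\<And>j. j < length As \<Longrightarrow> xs ! j \<in> bitstrings m"
    by blast+
  then show ?thesis by (auto simp: smp_inputs_def in_set_conv_nth)
qed

text \<open>The tags keep the right super-nodes apart, so meeting each of them in one node amounts
  to choosing one element of each set. As a labeling lies inside the right nodes, it is the union of
  these intersections and contains nothing else.\<close>

lemma labeling_iff:
  "labeling (instance_graph \<mu>) S \<longleftrightarrow>
    (\<exists>xs. list_all2 (\<lambda>x A. x \<in> set A) xs As \<and> S = choice_labels xs)"
proof
  assume S: "labeling (instance_graph \<mu>) S"
  have "\<exists>x. S \<inter> right_node j ` set (As ! j) = {right_node j x} \<and> x \<in> set (As ! j)"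
    if "j < length As" for j
  proof -
    have "(j, As ! j) \<in> set (numbered As)" using that by (simp add: numbered_mem_iff)
    then have "card (S \<inter> right_node j ` set (As ! j)) = 1"
      using S unfolding labeling_def right_super_graph by force
    then obtain v where v: "S \<inter> right_node j ` set (As ! j) = {v}" by (auto simp: card_1_singleton_iff)
    then have "v \<in> right_node j ` set (As ! j)" by blast
    with v show ?thesis by auto
  qed
  then obtain x where x: "\<And>j. j < length As \<Longrightarrow> S \<inter> right_node j ` set (As ! j) = {right_node j (x j)}"
    "\<And>j. j < length As \<Longrightarrow> x j \<in> set (As ! j)" by metis
  have "S = (\<Union>j<length As. S \<inter> right_node j ` set (As ! j))"
    using S unfolding labeling_def right_nodes_graph by blast
  also have "\<dots> = choice_labels (map x [0..<length As])"
    using x(1) by (auto simp: choice_labels_def)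
  finally show "\<exists>xs. list_all2 (\<lambda>x A. x \<in> set A) xs As \<and> S = choice_labels xs"
    using x(2) by (intro exI[of _ "map x [0..<length As]"]) (auto simp: list_all2_conv_all_nth)
next
  assume "\<exists>xs. list_all2 (\<lambda>x A. x \<in> set A) xs As \<and> S = choice_labels xs"
  then obtain xs where "list_all2 (\<lambda>x A. x \<in> set A) xs As" and S: "S = choice_labels xs"
    by blast
  then have xs: "\<And>j. j < length As \<Longrightarrow> xs ! j \<in> set (As ! j)"
    by (simp add: list_all2_conv_all_nth)
  have "S \<inter> right_node j ` set (As ! j) = {right_node j (xs ! j)}" if "j < length As" for j
    using that xs by (auto simp: S choice_labels_def)
  then show "labeling (instance_graph \<mu>) S"
    using xs by (auto simp: labeling_def right_super_graph right_nodes_graph numbered_mem_iff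
      S choice_labels_def)
qed

text \<open>The only message tuple compatible with a choice of inputs is their transcript.\<close>

lemma covers_iff:
  assumes "list_all2 (\<lambda>x A. x \<in> set A) xs As" "\<gamma> \<in> bitstrings r"
  shows "covers (instance_graph \<mu>) (choice_labels xs) (set (left_list \<mu> \<gamma>)) \<longleftrightarrow>
    acc \<mu> \<gamma> (transcript msg \<gamma> xs)"
proof
  have len: "length xs = length As" and xs: "\<And>j. j < length As \<Longrightarrow> xs ! j \<in> set (As ! j)"
    using assms(1) by (auto simp: list_all2_conv_all_nth)
  {
    assume "covers (instance_graph \<mu>) (choice_labels xs) (set (left_list \<mu> \<gamma>))"
    then obtain ms where ms: "ms \<in> smp_inputs l (length As)" "acc \<mu> \<gamma> ms" and
      "\<And>j. j < length As \<Longrightarrow> (left_node \<gamma> ms, right_node j (xs ! j)) \<in> edges (instance_graph \<mu>)"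
      unfolding covers_def set_left_list choice_labels_def by auto
    \<comment> \<open>Node names are injective, so an edge determines its coins, tuple, player and
      input.\<close>
    then have "\<And>j. j < length As \<Longrightarrow> msg j (xs ! j) \<gamma> = ms ! j"
      unfolding edge_iff by auto
    then have "transcript msg \<gamma> xs = ms"
      using ms(1) len by (auto simp: transcript_def smp_inputs_def intro!: nth_equalityI)
    with ms show "acc \<mu> \<gamma> (transcript msg \<gamma> xs)" by simp
  }
  assume acc: "acc \<mu> \<gamma> (transcript msg \<gamma> xs)"
  let ?ms = "transcript msg \<gamma> xs"
  have nth: "?ms ! j = msg j (xs ! j) \<gamma>" if "j < length As" for j
    using that len by (simp add: transcript_def)
  have "xs ! j \<in> bitstrings m" if "j < length As" for j
    using xs[OF that] sets that by force
  then have ms: "?ms \<in> smp_inputs l (length As)"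
    using msg assms(2) len by (auto simp: transcript_def smp_inputs_def)
  have "(left_node \<gamma> ?ms, right_node j (xs ! j)) \<in> edges (instance_graph \<mu>)" if "j < length As" for j
    unfolding edge_iff using that acc ms nth[OF that] xs[OF that] assms(2)
    by (intro exI[of _ \<gamma>] exI[of _ ?ms] exI[of _ j] exI[of _ "xs ! j"]) simp
  then show "covers (instance_graph \<mu>) (choice_labels xs) (set (left_list \<mu> \<gamma>))"
    unfolding covers_def set_left_list choice_labels_def using acc ms by blast
qed

text \<open>\<open>bit_lists r\<close> lists every coin string exactly once, so counting indices of
  covered super-nodes is counting accepting coins.\<close>

lemma covered_fraction_graph:
  assumes "list_all2 (\<lambda>x A. x \<in> set A) xs As"
  shows "covered_fraction (instance_graph \<mu>) (choice_labels xs) =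
    measure_pmf.prob (pmf_of_set (bitstrings r)) {\<gamma>. acc \<mu> \<gamma> (transcript msg \<gamma> xs)}"
proof -
  let ?L = "rev (bit_lists r)"
  let ?P = "\<lambda>\<gamma>. acc \<mu> \<gamma> (transcript msg \<gamma> xs)"
  have mem: "?L ! i \<in> bitstrings r" if "i < length ?L" for i
    using nth_mem[OF that] by (simp add: set_bit_lists)
  have "{i. i < length (left_super (instance_graph \<mu>)) \<and>
      covers (instance_graph \<mu>) (choice_labels xs) (left_super (instance_graph \<mu>) ! i)} =
      {i. i < length ?L \<and> ?P (?L ! i)}"
    unfolding left_super_graph using covers_iff[OF assms] mem by auto
  then have "covered_fraction (instance_graph \<mu>) (choice_labels xs) =
      real (card {\<gamma> \<in> bitstrings r. ?P \<gamma>}) / 2 ^ r"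
    unfolding covered_fraction_def using card_nth_filter[of ?L ?P]
    by (simp add: left_super_graph distinct_bit_lists length_bit_lists set_bit_lists)
  moreover have "bitstrings r \<noteq> {}"
    using card_bitstrings[of r] by auto
  ultimately show ?thesis
    by (simp add: measure_pmf_of_set card_bitstrings Int_def)
qed

lemma max_cover_graph:
  "max_cover (instance_graph \<mu>) = Max (insert 0
    ((\<lambda>xs. measure_pmf.prob (pmf_of_set (bitstrings r)) {\<gamma>. acc \<mu> \<gamma> (transcript msg \<gamma> xs)}) `
      {xs. list_all2 (\<lambda>x A. x \<in> set A) xs As}))"
proof -
  have "{S. labeling (instance_graph \<mu>) S} = choice_labels ` {xs. list_all2 (\<lambda>x A. x \<in> set A) xs As}"
    by (auto simp: labeling_iff)
  then have "covered_fraction (instance_graph \<mu>) ` {S. labeling (instance_graph \<mu>) S} =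
      (\<lambda>xs. measure_pmf.prob (pmf_of_set (bitstrings r)) {\<gamma>. acc \<mu> \<gamma> (transcript msg \<gamma> xs)}) `
        {xs. list_all2 (\<lambda>x A. x \<in> set A) xs As}"
    by (auto simp: image_image covered_fraction_graph intro!: image_cong)
  then show ?thesis unfolding max_cover_def by simp
qed

lemma finite_choices: "finite {xs. list_all2 (\<lambda>x A. x \<in> set A) xs As}"
proof (rule finite_subset)
  show "{xs. list_all2 (\<lambda>x A. x \<in> set A) xs As} \<subseteq> smp_inputs m (length As)"
    using choice_inputs by blast
  show "finite (smp_inputs m (length As))"
    unfolding smp_inputs_def
    using finite_lists_length_eq[OF finite_bitstrings[of m], of "length As"]
    by (simp add: conj_commute)
qed

lemma max_cover_yes:
  assumes "list_all2 (\<lambda>x A. x \<in> set A) xs As"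
    and "\<And>\<gamma>. \<gamma> \<in> bitstrings r \<Longrightarrow> acc \<mu> \<gamma> (transcript msg \<gamma> xs)"
  shows "max_cover (instance_graph \<mu>) = 1"
  unfolding max_cover_graph
proof (rule Max_eqI)
  have "bitstrings r \<noteq> {}" using card_bitstrings[of r] by auto
  then have "measure_pmf.prob (pmf_of_set (bitstrings r)) {\<gamma>. acc \<mu> \<gamma> (transcript msg \<gamma> xs)} = 1"
    using assms(2) by (subst measure_pmf.prob_eq_1) (auto simp: AE_measure_pmf_iff)
  then show "1 \<in> insert 0 ((\<lambda>xs. measure_pmf.prob (pmf_of_set (bitstrings r))
      {\<gamma>. acc \<mu> \<gamma> (transcript msg \<gamma> xs)}) ` {xs. list_all2 (\<lambda>x A. x \<in> set A) xs As})"
    using assms(1) by force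
qed (auto simp: finite_choices)

text \<open>The assumption \<open>0 \<le> s\<close> handles the default value 0 in
  \<open>max_cover\<close>, which is the maximum when some set is empty and no choice
  exists.\<close>

lemma max_cover_no:
  assumes "0 \<le> s" and "\<And>xs. list_all2 (\<lambda>x A. x \<in> set A) xs As \<Longrightarrow>
    measure_pmf.prob (pmf_of_set (bitstrings r)) {\<gamma>. acc \<mu> \<gamma> (transcript msg \<gamma> xs)} \<le> s"
  shows "max_cover (instance_graph \<mu>) \<le> s"
  unfolding max_cover_graph using assms by (subst Max_le_iff) (auto simp: finite_choices)

end

theorem theorem5p2:
  fixes m w r l :: "nat \<Rightarrow> nat \<Rightarrow> nat"
    and s :: "nat \<Rightarrow> nat \<Rightarrow> real"
    and f :: "nat \<Rightarrow> nat \<Rightarrow> bits list \<Rightarrow> bool"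
  assumes "efficient_protocols m f w r l s"
  shows "\<exists>(reduction :: prog) (p :: nat poly). \<forall>N k As. psp_instance (m N k) k N As \<longrightarrow>
    (\<exists>(\<Gamma> :: bits \<Rightarrow> (data, data) label_cover) (out :: bits \<Rightarrow> data).
       (\<forall>\<mu>\<in>bitstrings (w N k). label_cover_instance (\<Gamma> \<mu>) \<and> lists_label_cover (out \<mu>) (\<Gamma> \<mu>)) \<and>
       computes_within reduction
         (enc_list [enc_params N k (m N k) (w N k) (r N k) (l N k), enc_psp As])
         (enc_list (map out (List.n_lists (w N k) [False, True])))
         (2 ^ (w N k + r N k + l N k * k) * poly p (m N k) * psp_size As) \<and>
       (\<forall>\<mu>\<in>bitstrings (w N k).
          card (right_nodes (\<Gamma> \<mu>)) \<le> N * k \<and>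
          length (right_super (\<Gamma> \<mu>)) = k \<and>
          length (left_super (\<Gamma> \<mu>)) = 2 ^ r N k \<and>
          left_alphabet_size (\<Gamma> \<mu>) \<le> 2 ^ (l N k * k)) \<and>
       (psp_yes (f N k) As \<longrightarrow> (\<exists>\<mu>\<in>bitstrings (w N k). max_cover (\<Gamma> \<mu>) = 1)) \<and>
       (\<not> psp_yes (f N k) As \<longrightarrow> (\<forall>\<mu>\<in>bitstrings (w N k). max_cover (\<Gamma> \<mu>) \<le> s N k)))"
proof -
  obtain msg acc player referee and p :: "nat poly" where
    protocol: "\<And>N k. smp_protocol (m N k) k (f N k) (w N k) (r N k) (l N k) (s N k) (msg N k) (acc N k)"
    and player: "\<And>N k j x \<gamma>. j < k \<Longrightarrow> x \<in> bitstrings (m N k) \<Longrightarrow> \<gamma> \<in> bitstrings (r N k) \<Longrightarrow>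
      computes_within player (enc_list [enc_params N k (m N k) (w N k) (r N k) (l N k),
        enc_bits (binary j), enc_bits x, enc_bits \<gamma>])
        (enc_bits (msg N k j x \<gamma>)) (poly p (m N k))"
    and referee: "\<And>N k \<mu> \<gamma> ms. \<mu> \<in> bitstrings (w N k) \<Longrightarrow> \<gamma> \<in> bitstrings (r N k) \<Longrightarrow>
      ms \<in> smp_inputs (l N k) k \<Longrightarrow>
      computes_within referee (enc_list [enc_params N k (m N k) (w N k) (r N k) (l N k),
        enc_bits \<mu>, enc_bits \<gamma>, enc_list (map enc_bits ms)])
        (enc_bool (acc N k \<mu> \<gamma> ms)) (poly p (m N k))"
    using assms unfolding efficient_protocols_def Let_def by metis
  define V where "V = 2 * var_bound player + 2 * var_bound referee"
  \<comment> \<open>\<open>call_time\<close> is the value of \<open>p\<close> plus \<open>V\<close>,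
    and \<open>V\<close> depends on the two programs only, so one polynomial serves all
    \<open>N\<close> and \<open>k\<close>.\<close>
  define q where "q = smult 3 p + [:3 * V + 1000:]"
  show ?thesis
  proof (intro exI[of _ "reduction_prog player referee"] exI[of _ q] allI impI)
    fix N k As
    assume inst: "psp_instance (m N k) k N As"
    then have k: "length As = k" by (simp add: psp_instance_def)
    interpret smp_reduction player referee "enc_params N k (m N k) (w N k) (r N k) (l N k)"
      "poly p (m N k)" "m N k" "w N k" "r N k" "l N k" "msg N k" "acc N k" As
      by standard (use inst protocol[of N k] player referee in
        \<open>auto simp: psp_instance_def smp_protocol_def\<close>)
    have q: "poly q (m N k) = 3 * call_time + 1000"
      by (simp add: q_def V_def call_time_def)
    have time: "computes_within (reduction_prog player referee)
        (enc_list [enc_params N k (m N k) (w N k) (r N k) (l N k), enc_psp As])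
        (enc_list (map instance_data (bit_lists (w N k))))
        (2 ^ (w N k + r N k + l N k * k) * poly q (m N k) * psp_size As)"
      using computes_reduction_prog[OF enc_params_def] unfolding k q .
    have size: "card (right_nodes (instance_graph \<mu>)) \<le> N * k \<and>
        length (right_super (instance_graph \<mu>)) = k \<and>
        length (left_super (instance_graph \<mu>)) = 2 ^ r N k \<and>
        left_alphabet_size (instance_graph \<mu>) \<le> 2 ^ (l N k * k)" for \<mu>
      using card_right_nodes[of N \<mu>] left_alphabet_size_graph[of \<mu>] inst k
      by (auto simp: psp_instance_def right_super_graph left_super_graph length_bit_lists)
    have yes: "\<exists>\<mu>\<in>bitstrings (w N k). max_cover (instance_graph \<mu>) = 1" if yes: "psp_yes (f N k) As"
    proof -
      obtain xs where xs: "list_all2 (\<lambda>x A. x \<in> set A) xs As" "f N k xs"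
        using yes by (auto simp: psp_yes_def)
      then obtain \<mu> where "\<mu> \<in> bitstrings (w N k)"
        "\<And>\<gamma>. \<gamma> \<in> bitstrings (r N k) \<Longrightarrow> acc N k \<mu> \<gamma> (transcript (msg N k) \<gamma> xs)"
        using protocol[of N k] choice_inputs[OF xs(1)] k unfolding smp_protocol_def by blast
      then show ?thesis using max_cover_yes[OF xs(1)] by blast
    qed
    have no: "max_cover (instance_graph \<mu>) \<le> s N k"
      if "\<not> psp_yes (f N k) As" "\<mu> \<in> bitstrings (w N k)" for \<mu>
    proof (rule max_cover_no)
      show "0 \<le> s N k" using protocol[of N k] by (simp add: smp_protocol_def)
      fix xs assume xs: "list_all2 (\<lambda>x A. x \<in> set A) xs As"
      \<comment> \<open>In a NO instance every choice of inputs is a zero of \<open>f\<close>, so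
        soundness bounds each probability in the maximum, for any advice.\<close>
      then have "\<not> f N k xs" using that by (auto simp: psp_yes_def)
      then show "measure_pmf.prob (pmf_of_set (bitstrings (r N k)))
          {\<gamma>. acc N k \<mu> \<gamma> (transcript (msg N k) \<gamma> xs)} \<le> s N k"
        using protocol[of N k] choice_inputs[OF xs] k that(2) unfolding smp_protocol_def by blast
    qed
    show "\<exists>(\<Gamma> :: bits \<Rightarrow> (data, data) label_cover) (out :: bits \<Rightarrow> data).
       (\<forall>\<mu>\<in>bitstrings (w N k). label_cover_instance (\<Gamma> \<mu>) \<and> lists_label_cover (out \<mu>) (\<Gamma> \<mu>)) \<and>
       computes_within (reduction_prog player referee)
         (enc_list [enc_params N k (m N k) (w N k) (r N k) (l N k), enc_psp As])
         (enc_list (map out (List.n_lists (w N k) [False, True])))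
         (2 ^ (w N k + r N k + l N k * k) * poly q (m N k) * psp_size As) \<and>
       (\<forall>\<mu>\<in>bitstrings (w N k).
          card (right_nodes (\<Gamma> \<mu>)) \<le> N * k \<and>
          length (right_super (\<Gamma> \<mu>)) = k \<and>
          length (left_super (\<Gamma> \<mu>)) = 2 ^ r N k \<and>
          left_alphabet_size (\<Gamma> \<mu>) \<le> 2 ^ (l N k * k)) \<and>
       (psp_yes (f N k) As \<longrightarrow> (\<exists>\<mu>\<in>bitstrings (w N k). max_cover (\<Gamma> \<mu>) = 1)) \<and>
       (\<not> psp_yes (f N k) As \<longrightarrow> (\<forall>\<mu>\<in>bitstrings (w N k). max_cover (\<Gamma> \<mu>) \<le> s N k))"
      using label_cover_instance_graph lists_instance_graph time size yes no
      by (intro exI[of _ instance_graph] exI[of _ instance_data]) blast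
  qed
qed

end
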